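(* Let $\omega\in\mathbb{C}$ with $\operatorname{Im}\omega>0$, let $m\in\mathbb{Z}$, and let $\lambda$ be an eigenvalue of the angular ODE (with these $\omega,m$). If $u$ solves the homogeneous radial ODE $u''+(\omega^2-V)u=0$ (with these $\omega,m,\lambda$) and satisfies the mode boundary conditions, then $u\equiv0$. Equivalently, there is no nontrivial mode solution $\psi=e^{-i\omega t}e^{im\phi}S(\theta)(r^2+a^2)^{-1/2}u(r^*(r))$ of the wave equation on sub-extremal Kerr with $\operatorname{Im}\omega>0$.
   Context: Fix $M>0$ and $a\in\mathbb{R}$ with $|a|<M$. Let $r_\pm:=M\pm\sqrt{M^2-a^2}$ and $\Delta(r):=r^2-2Mr+a^2=(r-r_+)(r-r_-)$. Let $r^*:(r_+,\infty)\to(-\infty,\infty)$ be a fixed increasing bijection with $\frac{dr^*}{dr}=\frac{r^2+a^2}{\Delta}$; functions of $r\in(r_+,\infty)$ are identified with functions of $r^*\in\mathbb{R}$, and a prime $'$ denotes $d/dr^*$. Complex powers $(r-r_\pm)^c$ mean $e^{c\log(r-r_\pm)}$ with the real logarithm. Angular ODE: for $\omega\in\mathbb{C}$, $m\in\mathbb{Z}$, $\lambda\in\mathbb{C}$, $\frac{1}{\sin\theta}\frac{d}{d\theta}\big(\sin\theta\frac{dS}{d\theta}\big)-\big(\frac{m^2}{\sin^2\theta}-a^2\omega^2\cos^2\theta\big)S+\lambda S=0$ on $(0,\pi)$, together with the requirement that $e^{im\phi}S(\theta)$ extends to a smooth function on $\mathbb{S}^2$. A nonzero such $S$ is an angular eigenfunction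 with eigenvalue $\lambda$. Radial ODE: given $\omega,m,\lambda$, set $V:=\frac{4Mram\omega-a^2m^2+\Delta(\lambda+a^2\omega^2)}{(r^2+a^2)^2}+\frac{\Delta}{(r^2+a^2)^4}\big(a^2\Delta+2Mr(r^2-a^2)\big)$ (with $r=r(r^* )$), and consider $u''+(\omega^2-V)u=H$ ($H=0$: homogeneous). Mode boundary conditions for $u$: with $\xi:=\frac{i(am-2Mr_+\omega)}{r_+-r_-}$, (i) $(r-r_+)^{-\xi}u$, as a function of $r$, extends smoothly to $r=r_+$; (ii) there exist constants $C_0,C_1,\dots$ such that for every $N\ge1$, $u=e^{i\omega r^*}\sum_{i=0}^N C_i r^{-i}+O(r^{-N-1})$ as $r\to\infty$. *)

theory Defs
  imports "HOL-Analysis.Analysis"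
begin

primrec Ck_on :: "nat \<Rightarrow> 'a::real_normed_vector set \<Rightarrow> ('a \<Rightarrow> 'b::real_normed_vector) \<Rightarrow> bool" where
  "Ck_on 0 U f = continuous_on U f"
| "Ck_on (Suc k) U f = (f differentiable_on U \<and> (\<forall>v. Ck_on k U (\<lambda>x. frechet_derivative f (at x) v)))"

definition smooth_on :: "'a::real_normed_vector set \<Rightarrow> ('a \<Rightarrow> 'b::real_normed_vector) \<Rightarrow> bool" where
  "smooth_on U f \<longleftrightarrow> (\<forall>k. Ck_on k U f)"

definition r_plus :: "real \<Rightarrow> real \<Rightarrow> real" where
  "r_plus M a = M + sqrt (M^2 - a^2)"
definition r_minus :: "real \<Rightarrow> real \<Rightarrow> real" where
  "r_minus M a = M - sqrt (M^2 - a^2)"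
definition Delta :: "real \<Rightarrow> real \<Rightarrow> real \<Rightarrow> real" where
  "Delta M a r = r^2 - 2*M*r + a^2"

definition rcpow :: "real \<Rightarrow> complex \<Rightarrow> complex" where
  "rcpow x c = exp (c * complex_of_real (ln x))"

definition angular_eigenfunction :: "real \<Rightarrow> complex \<Rightarrow> int \<Rightarrow> complex \<Rightarrow> (real \<Rightarrow> complex) \<Rightarrow> bool" where
  "angular_eigenfunction a \<omega> m lam S \<longleftrightarrow>
     (\<exists>\<theta>\<in>{0<..<pi}. S \<theta> \<noteq> 0) \<and>
     (\<exists>S1 T. \<forall>\<theta>\<in>{0<..<pi}.
        (S has_vector_derivative S1 \<theta>) (at \<theta>) \<and>
        ((\<lambda>t. complex_of_real (sin t) * S1 t) has_vector_derivative T \<theta>) (at \<theta>) \<and>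
        T \<theta> / complex_of_real (sin \<theta>)
          - (complex_of_real ((of_int m)^2 / (sin \<theta>)^2) - (complex_of_real a)^2 * \<omega>^2 * complex_of_real ((cos \<theta>)^2)) * S \<theta>
          + lam * S \<theta> = 0) \<and>
     (\<exists>F :: real^3 \<Rightarrow> complex. smooth_on UNIV F \<and>
        (\<forall>\<theta>\<in>{0<..<pi}. \<forall>\<phi>::real.
           F (vector [sin \<theta> * cos \<phi>, sin \<theta> * sin \<phi>, cos \<theta>])
             = exp (\<i> * of_int m * complex_of_real \<phi>) * S \<theta>))"

definition angular_eigenvalue :: "real \<Rightarrow> complex \<Rightarrow> int \<Rightarrow> complex \<Rightarrow> bool" where
  "angular_eigenvalue a \<omega> m lam \<longleftrightarrow> (\<exists>S. angular_eigenfunction a \<omega> m lam S)"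

definition Vpot :: "real \<Rightarrow> real \<Rightarrow> complex \<Rightarrow> int \<Rightarrow> complex \<Rightarrow> real \<Rightarrow> complex" where
  "Vpot M a \<omega> m lam r =
     (complex_of_real (4*M*r*a* of_int m) * \<omega> - complex_of_real (a^2 * (of_int m)^2)
        + complex_of_real (Delta M a r) * (lam + complex_of_real (a^2) * \<omega>^2))
       / complex_of_real ((r^2 + a^2)^2)
     + complex_of_real (Delta M a r / (r^2 + a^2)^4 * (a^2 * Delta M a r + 2*M*r*(r^2 - a^2)))"

definition tortoise :: "real \<Rightarrow> real \<Rightarrow> (real \<Rightarrow> real) \<Rightarrow> bool" where
  "tortoise M a rs \<longleftrightarrow>
     strict_mono_on {r_plus M a<..} rs \<and> rs ` {r_plus M a<..} = UNIV \<and>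
     (\<forall>r\<in>{r_plus M a<..}. (rs has_real_derivative (r^2 + a^2) / Delta M a r) (at r))"

definition radial_hom_solution :: "real \<Rightarrow> real \<Rightarrow> (real \<Rightarrow> real) \<Rightarrow> complex \<Rightarrow> int \<Rightarrow> complex \<Rightarrow> (real \<Rightarrow> complex) \<Rightarrow> bool" where
  "radial_hom_solution M a rs \<omega> m lam u \<longleftrightarrow>
     (\<exists>u1 u2. (\<forall>x. (u has_vector_derivative u1 x) (at x) \<and> (u1 has_vector_derivative u2 x) (at x)) \<and>
        (\<forall>r\<in>{r_plus M a<..}. u2 (rs r) + (\<omega>^2 - Vpot M a \<omega> m lam r) * u (rs r) = 0))"

definition xi :: "real \<Rightarrow> real \<Rightarrow> complex \<Rightarrow> int \<Rightarrow> complex" where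
  "xi M a \<omega> m = \<i> * (complex_of_real (a * of_int m) - complex_of_real (2 * M * r_plus M a) * \<omega>)
                   / complex_of_real (r_plus M a - r_minus M a)"

definition mode_bc :: "real \<Rightarrow> real \<Rightarrow> (real \<Rightarrow> real) \<Rightarrow> complex \<Rightarrow> int \<Rightarrow> (real \<Rightarrow> complex) \<Rightarrow> bool" where
  "mode_bc M a rs \<omega> m u \<longleftrightarrow>
     (\<exists>g :: real \<Rightarrow> complex. smooth_on UNIV g \<and>
        (\<forall>r\<in>{r_plus M a<..}. g r = rcpow (r - r_plus M a) (- xi M a \<omega> m) * u (rs r))) \<and>
     (\<exists>C :: nat \<Rightarrow> complex. \<forall>N::nat. N \<ge> 1 \<longrightarrow>
        (\<exists>K R. \<forall>r. r > R \<longrightarrow>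
           cmod (u (rs r) - exp (\<i> * \<omega> * complex_of_real (rs r)) * (\<Sum>i\<le>N. C i / complex_of_real (r ^ i)))
             \<le> K / r ^ (N + 1)))"

end

theory Submission
  imports Defs "HOL-Complex_Analysis.Conformal_Mappings"
begin

text \<open>
  Put \<open>s = r - r\<^sub>-\<close>, \<open>D = r\<^sub>+ - r\<^sub>-\<close>, \<open>\<nu> = - i \<omega>\<close> (so \<open>Re \<nu> > 0\<close>) and \<open>R = (r\<^sup>2 + a\<^sup>2) powr (-1/2) * u\<close>, which solves
  a confluent Heun equation \<open>(s (s - D) R')' + W R = 0\<close>. Whiting's transform
  \<open>T z = \<integral>\<^sub>D\<^sup>\<infinity> exp (- (2 \<nu> z / D - \<nu>) s) s powr \<eta> (s - D) powr \<xi> R s ds\<close>, multiplied by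
  \<open>(z - D) powr (2 M \<nu>) * exp (\<nu> z)\<close>, solves an equation of the same form whose potential \<open>W'\<close>
  satisfies \<open>Re (cnj \<nu> * W') < 0\<close>: the ergoregion obstruction has disappeared. Here the sign of
  \<open>Re (cnj \<nu> * \<lambda>)\<close> comes from the angular equation. Hence the energy flux of the transformed
  solution is monotone; it vanishes at both ends, so \<open>T = 0\<close> for \<open>z > D\<close>. As \<open>T\<close> is a Laplace transform
  restricted to a ray, analytic continuation and Lerch's theorem give \<open>R = 0\<close>.
\<close>

section \<open>Moments of Laplace transforms\<close>

text \<open>The obstruction is the pole term \<open>- \<xi>^2 * D / (s - D)\<close> of the
  potential. As \<open>\<xi> = (2 M r_+ \<nu> + i a m) / D\<close>, the real part of
  \<open>cnj \<nu> * \<xi>^2\<close> is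
  \<open>Re \<nu> (4 M^2 r_+^2 |\<nu>|^2 - a^2 m^2) / D^2\<close>, negative once
  \<open>|a m|\<close> is large; the flux of \<open>R\<close> itself then need not be monotone. The
  kernel exponents \<open>\<eta>\<close>, \<open>\<xi>\<close> are indicial roots at
  \<open>s = 0\<close> and \<open>s = D\<close>, so the operator maps the kernel to itself times a
  quadratic polynomial in \<open>s\<close>. Integration by parts turns this into a second-order
  equation in \<open>p\<close> with singular points \<open>p = - \<nu>\<close> and
  \<open>p = \<nu>\<close>; \<open>z\<close> is the affine coordinate that puts them at
  \<open>0\<close> and \<open>D\<close>. The new exponents at \<open>z = D\<close> are plus and
  minus \<open>\<eta> + \<xi> = 2 M \<nu>\<close>, free of \<open>a m\<close>. What survives of
  \<open>a m\<close> is a real multiple of \<open>i \<nu>\<close>, which the multiplier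
  \<open>cnj \<nu>\<close> makes purely imaginary; the same multiplier turns \<open>\<nu>^2\<close>
  into \<open>|\<nu>|^2 \<nu>\<close>, whose real part is positive. The boundary conditions are used
  in the form that \<open>u\<close> is bounded. With the equation this bounds \<open>u'\<close>,
  removes the boundary terms and makes the transform converge beyond the endpoint
  \<open>p = \<nu>\<close>.\<close>

lemma power_le_fact_exp:
  fixes x :: real
  assumes "0 \<le> x"
  shows "x ^ k \<le> fact k * exp x"
proof -
  have "(\<Sum>n\<in>{k}. x ^ n /\<^sub>R fact n) \<le> (\<Sum>n. x ^ n /\<^sub>R fact n)"
    using assms by (intro sum_le_suminf summable_exp_generic) auto
  then show ?thesis
    by (simp add: exp_def field_simps)
qed

text \<open>Up to the factor \<open>(-1) ^ k\<close> this is the \<open>k\<close>-th derivative of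
  the Laplace transform at \<open>p\<close>. Keeping the power explicit lets derivatives in
  \<open>p\<close> and polynomial weights in \<open>s\<close> share one notation.\<close>

definition laplace_moment :: "real \<Rightarrow> (real \<Rightarrow> complex) \<Rightarrow> nat \<Rightarrow> complex \<Rightarrow> complex" where
  "laplace_moment D \<phi> k p = (LINT s:{D<..}|lborel. complex_of_real s ^ k * exp (- p * complex_of_real s) * \<phi> s)"

text \<open>The exponential type \<open>c\<close> gives the half-plane \<open>c < Re p\<close> of
  absolute convergence. It is later \<open>Re \<nu> / 2\<close>, strictly to the left of all
  parameters \<open>p\<close> that belong to \<open>D \<le> z\<close>.\<close>

locale laplace_data =
  fixes D c C :: real and \<phi> :: "real \<Rightarrow> complex"
  assumes D_pos: "0 < D"
    and cont: "continuous_on {D<..} \<phi>"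
    and bound: "\<And>s. D < s \<Longrightarrow> cmod (\<phi> s) \<le> C * exp (c * s)"
begin

abbreviation mom :: "nat \<Rightarrow> complex \<Rightarrow> complex" where
  "mom \<equiv> laplace_moment D \<phi>"

lemma C_nonneg: "0 \<le> C"
  using order_trans[OF norm_ge_zero bound[of "D + 1"]] by (simp add: zero_le_mult_iff)

lemma set_integrable_exp_decay:
  assumes "0 < d"
  shows "set_integrable lborel {D<..} (\<lambda>s. exp (- d * s))"
proof -
  have "(\<lambda>s. exp (- d * s)) absolutely_integrable_on {D..}"
    by (intro nonnegative_absolutely_integrable_1 integrable_on_exp_minus_to_infinity assms) auto
  then have "set_integrable lborel {D..} (\<lambda>s. exp (- d * s))"
    unfolding set_integrable_def by (subst (asm) integrable_completion) auto
  then show ?thesis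
    by (rule set_integrable_subset) auto
qed

lemma set_integrable_if_bounded:
  fixes f :: "real \<Rightarrow> complex"
  assumes "continuous_on {D<..} f" "0 < d"
    and "\<And>s. D < s \<Longrightarrow> cmod (f s) \<le> B * exp (- d * s)"
  shows "set_integrable lborel {D<..} f"
proof (rule set_integrable_bound)
  show "set_integrable lborel {D<..} (\<lambda>s. B * exp (- d * s))"
    using set_integrable_exp_decay[OF assms(2)] by (rule set_integrable_mult_right)
  show "set_borel_measurable lborel {D<..} f"
    unfolding set_borel_measurable_def using assms(1)
    by (simp add: borel_measurable_continuous_on_indicator)
  show "AE x in lborel. x \<in> {D<..} \<longrightarrow> norm (f x) \<le> norm (B * exp (- d * x))"
    by (intro AE_I2 impI) (use assms(3) in \<open>fastforce intro: order_trans\<close>)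
qed

lemma continuous_on_moment_integrand:
  "continuous_on {D<..} (\<lambda>s. complex_of_real s ^ k * exp (- p * complex_of_real s) * \<phi> s)"
  by (intro continuous_intros cont)

text \<open>The power is paid for with an arbitrarily small part \<open>e\<close> of the exponential
  decay.\<close>

lemma norm_moment_integrand_le:
  assumes "0 < e" "D < s"
  shows "cmod (complex_of_real s ^ k * exp (- p * complex_of_real s) * \<phi> s)
           \<le> fact k / e ^ k * C * exp (- (Re p - c - e) * s)"
proof -
  have "(e * s) ^ k \<le> fact k * exp (e * s)"
    using assms D_pos by (intro power_le_fact_exp) auto
  then have 1: "s ^ k \<le> fact k / e ^ k * exp (e * s)"
    using assms by (simp add: field_simps)
  have "cmod (complex_of_real s ^ k * exp (- p * complex_of_real s) * \<phi> s)
      = s ^ k * exp (- Re p * s) * cmod (\<phi> s)"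
    using assms D_pos by (simp add: norm_mult norm_power)
  also have "\<dots> \<le> (fact k / e ^ k * exp (e * s)) * exp (- Re p * s) * (C * exp (c * s))"
    using assms D_pos C_nonneg by (intro mult_mono 1 bound) auto
  also have "\<dots> = fact k / e ^ k * C * (exp (e * s) * exp (- Re p * s) * exp (c * s))"
    by simp
  also have "exp (e * s) * exp (- Re p * s) * exp (c * s) = exp (- (Re p - c - e) * s)"
    by (simp add: exp_add [symmetric] algebra_simps)
  finally show ?thesis .
qed

lemma set_integrable_moment:
  assumes "c < Re p"
  shows "set_integrable lborel {D<..} (\<lambda>s. complex_of_real s ^ k * exp (- p * complex_of_real s) * \<phi> s)"
proof (rule set_integrable_if_bounded[OF continuous_on_moment_integrand])
  show "0 < (Re p - c) / 2" using assms by simp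
  show "cmod (complex_of_real s ^ k * exp (- p * complex_of_real s) * \<phi> s)
      \<le> (fact k / ((Re p - c) / 2) ^ k * C) * exp (- ((Re p - c) / 2) * s)" if "D < s" for s
    using norm_moment_integrand_le[of "(Re p - c) / 2" s k p] that assms by (simp add: field_simps)
qed

lemma set_integrable_norm_moment:
  assumes "c < Re p"
  shows "set_integrable lborel {D<..} (\<lambda>s. s ^ k * exp (- Re p * s) * cmod (\<phi> s))"
proof -
  have "set_integrable lborel {D<..} (\<lambda>s. cmod (complex_of_real s ^ k * exp (- p * complex_of_real s) * \<phi> s))"
    using set_integrable_norm[OF set_integrable_moment[OF assms]] .
  then show ?thesis
    by (rule set_integrable_cong[THEN iffD1, rotated -1])
       (use D_pos in \<open>auto simp: norm_mult norm_power\<close>)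
qed

lemma norm_set_integral_le:
  fixes f :: "real \<Rightarrow> complex"
  assumes "set_integrable lborel {D<..} f" "set_integrable lborel {D<..} g"
    and "\<And>s. D < s \<Longrightarrow> cmod (f s) \<le> g s"
  shows "cmod (LINT s:{D<..}|lborel. f s) \<le> (LINT s:{D<..}|lborel. g s)"
proof -
  have "cmod (LINT s:{D<..}|lborel. f s) \<le> (LINT s:{D<..}|lborel. cmod (f s))"
    by (rule set_integral_norm_bound[OF assms(1)])
  also have "\<dots> \<le> (LINT s:{D<..}|lborel. g s)"
    by (intro set_integral_mono set_integrable_norm assms) auto
  finally show ?thesis .
qed

text \<open>Integration starts at \<open>D\<close>, so every additional unit of \<open>Re p\<close>
  gains a factor \<open>exp (- D)\<close>. This gain later beats the growth of
  \<open>\<sigma>\<close> at infinity.\<close>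

lemma norm_moment_le:
  assumes "c < Re q" "Re q \<le> Re p"
  shows "cmod (mom k p) \<le> exp (- (Re p - Re q) * D) * (LINT s:{D<..}|lborel. s ^ k * exp (- Re q * s) * cmod (\<phi> s))"
proof -
  have "cmod (mom k p) \<le> (LINT s:{D<..}|lborel. exp (- (Re p - Re q) * D) * (s ^ k * exp (- Re q * s) * cmod (\<phi> s)))"
    unfolding laplace_moment_def
  proof (rule norm_set_integral_le)
    show "set_integrable lborel {D<..} (\<lambda>s. complex_of_real s ^ k * exp (- p * complex_of_real s) * \<phi> s)"
      using assms by (intro set_integrable_moment) auto
    show "set_integrable lborel {D<..} (\<lambda>s. exp (- (Re p - Re q) * D) * (s ^ k * exp (- Re q * s) * cmod (\<phi> s)))"
      by (intro set_integrable_mult_right set_integrable_norm_moment assms)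
    fix s assume s: "D < s"
    have "(Re p - Re q) * D \<le> (Re p - Re q) * s"
      using assms s by (intro mult_left_mono) auto
    then have "exp (- Re p * s) \<le> exp (- (Re p - Re q) * D) * exp (- Re q * s)"
      by (simp add: exp_add [symmetric] algebra_simps)
    then have "s ^ k * cmod (\<phi> s) * exp (- Re p * s)
        \<le> s ^ k * cmod (\<phi> s) * (exp (- (Re p - Re q) * D) * exp (- Re q * s))"
      using s D_pos by (intro mult_left_mono) auto
    then show "cmod (complex_of_real s ^ k * exp (- p * complex_of_real s) * \<phi> s)
        \<le> exp (- (Re p - Re q) * D) * (s ^ k * exp (- Re q * s) * cmod (\<phi> s))"
      using s D_pos by (simp add: norm_mult norm_power mult_ac)
  qed
  then show ?thesis by simp
qed

text \<open>Differentiation under the integral: the second-order Taylor remainder of the exponential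
  bounds the error by \<open>|h|^2\<close> times a convergent integral.\<close>

lemma moment_has_field_derivative:
  assumes "c < Re p"
  shows "(mom k has_field_derivative - mom (Suc k) p) (at p)"
proof -
  define d where "d = (Re p - c) / 2"
  have d: "0 < d" using assms by (simp add: d_def)
  \<comment> \<open>Moving left by half the gap absorbs the factor \<open>exp (d * s)\<close> of the
    Taylor remainder, while \<open>Re q\<close> stays above \<open>c\<close>.\<close>
  define q where "q = p - of_real d"
  have q: "Re q = Re p - d" "c < Re q" using assms by (simp_all add: q_def d_def field_simps)
  define B where "B = (LINT s:{D<..}|lborel. s ^ (k + 2) * exp (- Re q * s) * cmod (\<phi> s))"
  have est: "cmod (mom k (p + h) - mom k p - h * - mom (Suc k) p) \<le> (cmod h)\<^sup>2 * B" if h: "cmod h < d" for h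
  proof -
    have Rh: "\<bar>Re h\<bar> \<le> d" using h abs_Re_le_cmod[of h] by linarith
    have ph: "c < Re (p + h)" using Rh d by (simp add: d_def)
    note i1 = set_integrable_moment[OF ph, of k] and i2 = set_integrable_moment[OF assms, of k]
      and i3 = set_integrable_mult_right[of h, OF set_integrable_moment[OF assms, of "Suc k"]]
    let ?f = "\<lambda>s. complex_of_real s ^ k * exp (- (p + h) * complex_of_real s) * \<phi> s
        - complex_of_real s ^ k * exp (- p * complex_of_real s) * \<phi> s
        + h * (complex_of_real s ^ Suc k * exp (- p * complex_of_real s) * \<phi> s)"
    have eq: "mom k (p + h) - mom k p - h * - mom (Suc k) p = (LINT s:{D<..}|lborel. ?f s)"
      unfolding laplace_moment_def
      by (subst set_integral_add(2)[OF set_integral_diff(1)[OF i1 i2] i3], subst set_integral_diff(2)[OF i1 i2]) simp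
    have "cmod (LINT s:{D<..}|lborel. ?f s) \<le> (LINT s:{D<..}|lborel. (cmod h)\<^sup>2 * (s ^ (k + 2) * exp (- Re q * s) * cmod (\<phi> s)))"
    proof (rule norm_set_integral_le)
      show "set_integrable lborel {D<..} ?f"
        by (intro set_integral_add(1) set_integral_diff(1) i1 i2 i3)
      show "set_integrable lborel {D<..} (\<lambda>s. (cmod h)\<^sup>2 * (s ^ (k + 2) * exp (- Re q * s) * cmod (\<phi> s)))"
        by (intro set_integrable_mult_right set_integrable_norm_moment q)
      fix s assume "D < s"
      then have s: "0 < s" using D_pos by simp
      let ?w = "- h * complex_of_real s"
      have "cmod (exp ?w - (\<Sum>i\<le>1. ?w ^ i / fact i)) \<le> exp \<bar>Re ?w\<bar> * cmod ?w ^ Suc 1 / fact 1"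
        by (rule Taylor_exp)
      then have T: "cmod (exp ?w - 1 - ?w) \<le> exp \<bar>Re ?w\<bar> * (cmod ?w)\<^sup>2"
        by (simp add: power2_eq_square algebra_simps)
      have "\<bar>Re ?w\<bar> \<le> d * s"
        using Rh s by (simp add: abs_mult)
      then have "exp \<bar>Re ?w\<bar> * (cmod ?w)\<^sup>2 \<le> exp (d * s) * ((cmod h)\<^sup>2 * s\<^sup>2)"
        using s by (simp add: norm_mult power_mult_distrib mult_right_mono)
      with T have T2: "cmod (exp ?w - 1 - ?w) \<le> exp (d * s) * ((cmod h)\<^sup>2 * s\<^sup>2)" by linarith
      have e: "exp (- (p + h) * complex_of_real s) = exp (- p * complex_of_real s) * exp ?w"
        by (simp only: exp_add [symmetric]) (simp add: algebra_simps)
      have "?f s = complex_of_real s ^ k * exp (- p * complex_of_real s) * \<phi> s * (exp ?w - 1 - ?w)"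
        unfolding e by (simp add: algebra_simps)
      then have "cmod (?f s) = s ^ k * exp (- Re p * s) * cmod (\<phi> s) * cmod (exp ?w - 1 - ?w)"
        using s by (simp add: norm_mult norm_power)
      also have "\<dots> \<le> s ^ k * exp (- Re p * s) * cmod (\<phi> s) * (exp (d * s) * ((cmod h)\<^sup>2 * s\<^sup>2))"
        using s by (intro mult_left_mono T2) auto
      also have "\<dots> = (cmod h)\<^sup>2 * (s ^ (k + 2) * (exp (- Re p * s) * exp (d * s)) * cmod (\<phi> s))"
        by (simp add: power_add power2_eq_square)
      also have "exp (- Re p * s) * exp (d * s) = exp (- Re q * s)"
        by (simp add: q exp_add [symmetric] algebra_simps)
      finally show "cmod (?f s) \<le> (cmod h)\<^sup>2 * (s ^ (k + 2) * exp (- Re q * s) * cmod (\<phi> s))" .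
    qed
    also have "\<dots> = (cmod h)\<^sup>2 * B" by (simp add: B_def)
    finally show ?thesis unfolding eq .
  qed
  have "(\<lambda>h. (mom k (p + h) - mom k p) / h - - mom (Suc k) p) \<midarrow>0\<rightarrow> 0"
  proof (rule Lim_null_comparison)
    show "((\<lambda>h. cmod h * B) \<longlongrightarrow> 0) (at 0)"
      by (auto intro!: tendsto_eq_intros)
    have "eventually (\<lambda>h. cmod h < d) (at (0::complex))"
      using d by (auto simp: eventually_at intro!: exI[of _ d])
    moreover have "eventually (\<lambda>h. h \<noteq> 0) (at (0::complex))" by (simp add: eventually_at_filter)
    ultimately show "\<forall>\<^sub>F h in at 0. cmod ((mom k (p + h) - mom k p) / h - - mom (Suc k) p) \<le> cmod h * B"
    proof eventually_elim
      case (elim h)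
      have "(mom k (p + h) - mom k p) / h - - mom (Suc k) p = (mom k (p + h) - mom k p - h * - mom (Suc k) p) / h"
        using elim by (simp add: field_simps)
      then have "cmod ((mom k (p + h) - mom k p) / h - - mom (Suc k) p) \<le> (cmod h)\<^sup>2 * B / cmod h"
        using est[OF elim(1)] elim(2) by (simp add: norm_divide divide_right_mono)
      then show ?case using elim(2) by (simp add: power2_eq_square)
    qed
  qed
  then show ?thesis
    unfolding DERIV_def by (rule LIM_zero_cancel)
qed

lemma moment_holomorphic: "mom k holomorphic_on {p. c < Re p}"
  using moment_has_field_derivative
  by (auto simp: holomorphic_on_open open_halfspace_Re_gt)

section \<open>Uniqueness for Laplace transforms through Bernstein polynomials\<close>

text \<open>With \<open>t = exp (- s)\<close>, the case \<open>k = 0\<close> is the vanishing of the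
  transform at the integer \<open>N + j\<close>, and
  \<open>(1 - t) ^ Suc k = (1 - t) ^ k - t * (1 - t) ^ k\<close> does the induction. Integrability
  is carried along because subtracting integrals requires it.\<close>

lemma set_integral_bernstein_eq_0:
  assumes "\<And>p. c < Re p \<Longrightarrow> mom 0 p = 0" "c < real N"
  defines "\<psi> \<equiv> \<lambda>s. complex_of_real (exp (- real N * s)) * \<phi> s"
  shows "set_integrable lborel {D<..} (\<lambda>s. complex_of_real (exp (- s) ^ j * (1 - exp (- s)) ^ k) * \<psi> s)
       \<and> (LINT s:{D<..}|lborel. complex_of_real (exp (- s) ^ j * (1 - exp (- s)) ^ k) * \<psi> s) = 0"
proof (induction k arbitrary: j)
  case 0
  have p: "c < Re (of_nat (N + j))" using assms(2) by simp
  have eq: "complex_of_real (exp (- s) ^ j * (1 - exp (- s)) ^ 0) * \<psi> s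
      = complex_of_real s ^ 0 * exp (- of_nat (N + j) * complex_of_real s) * \<phi> s" for s
  proof -
    have "exp (- s) ^ j * exp (- real N * s) = exp (- real (N + j) * s)"
      by (simp add: exp_of_nat_mult [symmetric] exp_add [symmetric] algebra_simps)
    then have "complex_of_real (exp (- s) ^ j * exp (- real N * s)) = exp (- of_nat (N + j) * complex_of_real s)"
      by (simp only: flip: exp_of_real) simp
    then show ?thesis
      by (simp add: \<psi>_def)
  qed
  show ?case
    unfolding eq using set_integrable_moment[OF p, of 0] assms(1)[OF p]
    by (simp add: laplace_moment_def)
next
  case (Suc k)
  have eq: "complex_of_real (exp (- s) ^ j * (1 - exp (- s)) ^ Suc k) * \<psi> s
     = complex_of_real (exp (- s) ^ j * (1 - exp (- s)) ^ k) * \<psi> s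
       - complex_of_real (exp (- s) ^ Suc j * (1 - exp (- s)) ^ k) * \<psi> s" for s
    by (simp add: algebra_simps)
  show ?case
    unfolding eq using Suc.IH[of j] Suc.IH[of "Suc j"] set_integral_diff[of lborel "{D<..}"]
    by fastforce
qed

text \<open>The Bernstein polynomials of \<open>h\<close> integrate to zero against
  \<open>\<psi>\<close> and converge uniformly to \<open>h\<close>, so the integral is at most
  \<open>e * J\<close> with \<open>J\<close> the L1 norm of \<open>\<psi>\<close>.\<close>

lemma set_integral_continuous_weight_eq_0:
  fixes h :: "real \<Rightarrow> real"
  assumes "\<And>p. c < Re p \<Longrightarrow> mom 0 p = 0" "c < real N" and h: "continuous_on {0..1} h"
  defines "\<psi> \<equiv> \<lambda>s. complex_of_real (exp (- real N * s)) * \<phi> s"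
  shows "(LINT s:{D<..}|lborel. complex_of_real (h (exp (- s))) * \<psi> s) = 0"
proof -
  have p: "c < Re (of_nat N)" using assms(2) by simp
  have norm_\<psi>: "cmod (\<psi> s) = exp (- real N * s) * cmod (\<phi> s)" for s
    by (simp add: \<psi>_def norm_mult)
  have cont_\<psi>: "continuous_on {D<..} \<psi>"
    unfolding \<psi>_def by (intro continuous_intros cont)
  have int_\<psi>: "set_integrable lborel {D<..} (\<lambda>s. cmod (\<psi> s))"
    using set_integrable_norm_moment[OF p, of 0] unfolding norm_\<psi> by simp
  define J where "J = (LINT s:{D<..}|lborel. cmod (\<psi> s))"
  have J: "0 \<le> J" unfolding J_def set_lebesgue_integral_def by (rule Bochner_Integration.integral_nonneg) auto
  have unit: "exp (- s) \<in> {0..1}" if "D < s" for s :: real using that D_pos by auto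
  have cont_h: "continuous_on {D<..} (\<lambda>s. h (exp (- s)))"
    by (rule continuous_on_compose2[OF h]) (use unit in \<open>auto intro!: continuous_intros\<close>)
  obtain H where H: "\<And>t. t \<in> {0..1} \<Longrightarrow> \<bar>h t\<bar> \<le> H"
    using compact_imp_bounded[OF compact_continuous_image[OF h compact_Icc]]
    unfolding bounded_iff by (metis imageI real_norm_def)
  have int_h: "set_integrable lborel {D<..} (\<lambda>s. complex_of_real (h (exp (- s))) * \<psi> s)"
  proof (rule set_integrable_bound[OF set_integrable_mult_right[of H, OF int_\<psi>]])
    show "set_borel_measurable lborel {D<..} (\<lambda>s. complex_of_real (h (exp (- s))) * \<psi> s)"
      unfolding set_borel_measurable_def
      using borel_measurable_continuous_on_indicator[of "{D<..}" "\<lambda>s. complex_of_real (h (exp (- s))) * \<psi> s"]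
        cont_h cont_\<psi>
      by (simp add: continuous_on_mult continuous_on_of_real)
    show "AE s in lborel. s \<in> {D<..} \<longrightarrow>
        norm (complex_of_real (h (exp (- s))) * \<psi> s) \<le> norm (H * cmod (\<psi> s))"
      using H[OF unit] by (intro AE_I2 impI) (fastforce simp: norm_mult abs_mult intro!: mult_right_mono)
  qed
  have "cmod (LINT s:{D<..}|lborel. complex_of_real (h (exp (- s))) * \<psi> s) \<le> e * J" if e: "0 < e" for e
  proof -
    from Bernstein_Weierstrass[OF h e] obtain n where
      n: "\<And>x. x \<in> {0..1} \<Longrightarrow> \<bar>h x - (\<Sum>k\<le>n. h (real k / real n) * Bernstein n k x)\<bar> < e"
      by blast
    define b where "b x = (\<Sum>k\<le>n. h (real k / real n) * Bernstein n k x)" for x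
    have b_eq: "complex_of_real (b (exp (- s))) * \<psi> s
      = (\<Sum>k\<le>n. complex_of_real (h (real k / real n) * real (n choose k)) *
          (complex_of_real (exp (- s) ^ k * (1 - exp (- s)) ^ (n - k)) * \<psi> s))" for s
      by (simp add: b_def Bernstein_def sum_distrib_left mult_ac)
    have bern: "set_integrable lborel {D<..} (\<lambda>s. complex_of_real (exp (- s) ^ k * (1 - exp (- s)) ^ (n - k)) * \<psi> s)
       \<and> (LINT s:{D<..}|lborel. complex_of_real (exp (- s) ^ k * (1 - exp (- s)) ^ (n - k)) * \<psi> s) = 0" for k
      unfolding \<psi>_def by (rule set_integral_bernstein_eq_0) (use assms in auto)
    have "set_integrable lborel {D<..} (\<lambda>s. \<Sum>k\<in>A. d k * F k s) \<and> (LINT s:{D<..}|lborel. \<Sum>k\<in>A. d k * F k s) = 0"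
      if "finite A" "\<And>k. set_integrable lborel {D<..} (F k) \<and> (LINT s:{D<..}|lborel. F k s) = 0"
      for A and d :: "nat \<Rightarrow> complex" and F
      using that
    proof (induction A rule: finite_induct)
      case empty
      show ?case by (simp add: set_integrable_def set_lebesgue_integral_def)
    next
      case (insert k A)
      then show ?case
        using set_integral_add[of lborel "{D<..}" "\<lambda>s. d k * F k s" "\<lambda>s. \<Sum>k\<in>A. d k * F k s"]
        by simp
    qed
    from this[of "{..n}" "\<lambda>k s. complex_of_real (exp (- s) ^ k * (1 - exp (- s)) ^ (n - k)) * \<psi> s"
        "\<lambda>k. complex_of_real (h (real k / real n) * real (n choose k))", OF finite_atMost bern]
    have int_b: "set_integrable lborel {D<..} (\<lambda>s. complex_of_real (b (exp (- s))) * \<psi> s)"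
      and b0: "(LINT s:{D<..}|lborel. complex_of_real (b (exp (- s))) * \<psi> s) = 0"
      unfolding b_eq by (rule conjunct1, rule conjunct2)
    have eq: "(LINT s:{D<..}|lborel. complex_of_real (h (exp (- s))) * \<psi> s)
        = (LINT s:{D<..}|lborel. complex_of_real (h (exp (- s))) * \<psi> s - complex_of_real (b (exp (- s))) * \<psi> s)"
      using int_h int_b b0 by simp
    have "cmod (LINT s:{D<..}|lborel. complex_of_real (h (exp (- s))) * \<psi> s - complex_of_real (b (exp (- s))) * \<psi> s)
        \<le> (LINT s:{D<..}|lborel. e * cmod (\<psi> s))"
    proof (rule norm_set_integral_le)
      show "set_integrable lborel {D<..} (\<lambda>s. complex_of_real (h (exp (- s))) * \<psi> s - complex_of_real (b (exp (- s))) * \<psi> s)"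
        using int_h int_b by (rule set_integral_diff(1))
      show "set_integrable lborel {D<..} (\<lambda>s. e * cmod (\<psi> s))"
        using int_\<psi> by (rule set_integrable_mult_right)
      fix s assume "D < s"
      then have "\<bar>h (exp (- s)) - b (exp (- s))\<bar> \<le> e"
        using n[OF unit] by (simp add: b_def less_imp_le)
      moreover have "cmod (complex_of_real (h (exp (- s))) * \<psi> s - complex_of_real (b (exp (- s))) * \<psi> s)
          = \<bar>h (exp (- s)) - b (exp (- s))\<bar> * cmod (\<psi> s)"
        by (simp only: left_diff_distrib [symmetric] of_real_diff [symmetric] norm_mult norm_of_real)
      ultimately show "cmod (complex_of_real (h (exp (- s))) * \<psi> s - complex_of_real (b (exp (- s))) * \<psi> s) \<le> e * cmod (\<psi> s)"
        by (simp add: mult_right_mono)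
    qed
    also have "\<dots> = e * J" by (simp add: J_def)
    finally show ?thesis using eq by simp
  qed
  note small = this
  have "cmod (LINT s:{D<..}|lborel. complex_of_real (h (exp (- s))) * \<psi> s) \<le> 0 + e" if "0 < e" for e
  proof -
    \<comment> \<open>Dividing by \<open>J + 1\<close> instead of \<open>J\<close> covers
      \<open>J = 0\<close>.\<close>
    have "e / (J + 1) * J \<le> e" using J that by (simp add: field_simps)
    with small[of "e / (J + 1)"] J that show ?thesis by simp
  qed
  then have "cmod (LINT s:{D<..}|lborel. complex_of_real (h (exp (- s))) * \<psi> s) \<le> 0"
    by (rule field_le_epsilon)
  then show ?thesis by simp
qed

text \<open>Lerch's uniqueness theorem: after the substitution \<open>t = exp (- s)\<close> the values of the transform
  at large integers are moments on the unit interval.\<close>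
lemma eq_0_if_moment_0_eq_0:
  assumes mom0: "\<And>p. c < Re p \<Longrightarrow> mom 0 p = 0" and lim: "(\<phi> \<longlongrightarrow> 0) (at_right D)" and s: "D < s"
  shows "\<phi> s = 0"
proof -
  \<comment> \<open>The surplus of one over \<open>c\<close> makes the weight \<open>h\<close> below
    of order \<open>t\<close> at \<open>t = 0\<close>, hence continuous there.\<close>
  define N where "N = nat \<lceil>\<bar>c\<bar> + 1\<rceil>"
  have N: "c + 1 \<le> real N" "c < real N" unfolding N_def by linarith+
  \<comment> \<open>By the limit hypothesis the extension by zero is continuous across
    \<open>D\<close>. Test functions built from it are therefore continuous on the whole line, as
    needed for weights on all of the unit interval.\<close>
  define \<phi>0 where "\<phi>0 x = (if x \<le> D then 0 else \<phi> x)" for x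
  have cont0: "continuous_on UNIV \<phi>0"
  proof (intro continuous_at_imp_continuous_on ballI)
    fix x
    consider "x < D" | "x = D" | "D < x" by linarith
    then show "isCont \<phi>0 x"
    proof cases
      case 1
      have "eventually (\<lambda>y. \<phi>0 y = 0) (nhds x)"
        using eventually_nhds_in_open[of "{..<D}" x] 1 by (auto elim!: eventually_mono simp: \<phi>0_def)
      then show ?thesis by (simp add: isCont_cong)
    next
      case 3
      have "eventually (\<lambda>y. \<phi>0 y = \<phi> y) (nhds x)"
        using eventually_nhds_in_open[of "{D<..}" x] 3 by (auto elim!: eventually_mono simp: \<phi>0_def)
      moreover have "isCont \<phi> x" using cont 3 by (simp add: continuous_on_eq_continuous_at)
      ultimately show ?thesis by (simp add: isCont_cong)
    next
      case 2
      have "(\<phi>0 \<longlongrightarrow> 0) (at_left D)"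
        by (rule tendsto_eventually) (auto simp: eventually_at_filter \<phi>0_def)
      moreover have "(\<phi>0 \<longlongrightarrow> 0) (at_right D)"
        using lim by (rule Lim_transform_eventually) (auto simp: eventually_at_filter \<phi>0_def)
      ultimately show ?thesis
        unfolding 2 isCont_def by (subst filterlim_at_split) (simp add: \<phi>0_def)
    qed
  qed
  \<comment> \<open>A test function \<open>f\<close> in \<open>s\<close> becomes the weight
    \<open>t ^ N * f (- ln t)\<close> in \<open>t = exp (- s)\<close>. The exponent
    \<open>2 * N\<close> collects one \<open>N\<close> from this weight and one from
    \<open>\<psi>\<close> in the preceding lemma.\<close>
  have weight: "(LINT s:{D<..}|lborel. complex_of_real (f s * exp (- real (2 * N) * s)) * \<phi> s) = 0"
    if f: "continuous_on UNIV f" "\<And>s. \<bar>f s\<bar> \<le> cmod (\<phi>0 s)" for f :: "real \<Rightarrow> real"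
  proof -
    define h where "h t = (if t \<le> 0 then 0 else t ^ N * f (- ln t))" for t
    have h_le: "\<bar>h t\<bar> \<le> C * t" if t: "0 < t" "t \<le> 1" for t
    proof -
      have "cmod (\<phi>0 (- ln t)) \<le> C * exp (c * - ln t)"
        using bound[of "- ln t"] C_nonneg by (auto simp: \<phi>0_def)
      then have "\<bar>f (- ln t)\<bar> \<le> C * exp (c * - ln t)" using f(2) order_trans by blast
      then have "t ^ N * \<bar>f (- ln t)\<bar> \<le> t ^ N * (C * exp (c * - ln t))"
        using t by (intro mult_left_mono) auto
      also have tN: "t ^ N = exp (real N * ln t)" using t by (simp add: exp_of_nat_mult)
      also have "exp (real N * ln t) * (C * exp (c * - ln t)) = C * exp ((real N - c) * ln t)"
        by (simp add: exp_add [symmetric] exp_diff algebra_simps)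
      also have "\<dots> \<le> C * exp (1 * ln t)"
        using t N C_nonneg by (intro mult_left_mono exp_le_cancel_iff[THEN iffD2] mult_right_mono_neg) auto
      finally show ?thesis using t by (simp add: h_def abs_mult tN)
    qed
    have "continuous_on {0..1} h"
    proof (intro continuous_on_eq_continuous_within[THEN iffD2] ballI)
      fix t :: real assume t: "t \<in> {0..1}"
      show "continuous (at t within {0..1}) h"
      proof (cases "t = 0")
        case True
        have "(h \<longlongrightarrow> 0) (at 0 within {0..1})"
        proof (rule Lim_null_comparison)
          show "((\<lambda>t. C * t) \<longlongrightarrow> 0) (at 0 within {0..1})" by (auto intro!: tendsto_eq_intros)
          show "\<forall>\<^sub>F t in at 0 within {0..1}. norm (h t) \<le> C * t"
            using h_le by (auto simp: eventually_at_filter intro!: always_eventually)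
        qed
        then show ?thesis using True by (simp add: continuous_within h_def)
      next
        case False
        then have t0: "0 < t" using t by simp
        have "isCont (\<lambda>t. t ^ N * f (- ln t)) t"
          using f(1) t0 by (intro continuous_intros isCont_o2[of _ "\<lambda>t. - ln t" f])
            (auto simp: continuous_on_eq_continuous_at)
        moreover have "eventually (\<lambda>y. h y = y ^ N * f (- ln y)) (nhds t)"
          using eventually_nhds_in_open[of "{0<..}" t] t0 by (auto elim!: eventually_mono simp: h_def)
        ultimately have "isCont h t" by (simp add: isCont_cong)
        then show ?thesis by (rule continuous_at_imp_continuous_within)
      qed
    qed
    from set_integral_continuous_weight_eq_0[OF mom0 N(2) this]
    have "(LINT s:{D<..}|lborel. complex_of_real (h (exp (- s))) * (complex_of_real (exp (- real N * s)) * \<phi> s)) = 0"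
      by simp
    moreover have "complex_of_real (h (exp (- s))) * (complex_of_real (exp (- real N * s)) * \<phi> s)
        = complex_of_real (f s * exp (- real (2 * N) * s)) * \<phi> s" for s
    proof -
      have "exp (- s) ^ N * exp (- real N * s) = exp (- real (2 * N) * s)"
        by (simp add: exp_of_nat_mult [symmetric] exp_add [symmetric] algebra_simps)
      moreover have "h (exp (- s)) * exp (- real N * s) = f s * (exp (- s) ^ N * exp (- real N * s))"
        by (simp add: h_def)
      ultimately have "h (exp (- s)) * exp (- real N * s) = f s * exp (- real (2 * N) * s)"
        by (simp only:)
      then show ?thesis by (simp only: mult.assoc [symmetric] of_real_mult [symmetric])
    qed
    ultimately show ?thesis by (simp only:)
  qed
  have le: "cmod (\<phi> s) \<le> C * exp (c * s)" if "D < s" for s using bound[OF that] .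
  define g where "g s = (cmod (\<phi>0 s))\<^sup>2 * exp (- real (2 * N) * s)" for s
  have comp_int: "set_integrable lborel {D<..} (\<lambda>s. complex_of_real (f s * exp (- real (2 * N) * s)) * \<phi> s)"
    if f: "continuous_on UNIV f" "\<And>s. \<bar>f s\<bar> \<le> cmod (\<phi>0 s)" for f :: "real \<Rightarrow> real"
  proof (rule set_integrable_if_bounded)
    show "continuous_on {D<..} (\<lambda>s. complex_of_real (f s * exp (- real (2 * N) * s)) * \<phi> s)"
      by (intro continuous_intros cont continuous_on_subset[OF f(1)]) auto
    show "0 < 2 * (real N - c)" using N by simp
    fix s assume s: "D < s"
    have "cmod (complex_of_real (f s * exp (- real (2 * N) * s)) * \<phi> s)
        = \<bar>f s\<bar> * cmod (\<phi> s) * exp (- real (2 * N) * s)"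
      by (simp add: norm_mult)
    also have "\<dots> \<le> (C * exp (c * s)) * (C * exp (c * s)) * exp (- real (2 * N) * s)"
      using f(2)[of s] le[OF s] s by (intro mult_mono) (auto simp: \<phi>0_def C_nonneg)
    also have "\<dots> = C\<^sup>2 * (exp (c * s) * exp (c * s) * exp (- real (2 * N) * s))"
      by (simp add: power2_eq_square)
    also have "exp (c * s) * exp (c * s) * exp (- real (2 * N) * s) = exp (- (2 * (real N - c)) * s)"
      by (simp add: exp_add [symmetric] algebra_simps)
    finally show "cmod (complex_of_real (f s * exp (- real (2 * N) * s)) * \<phi> s) \<le> C\<^sup>2 * exp (- (2 * (real N - c)) * s)" .
  qed
  \<comment> \<open>Taking the real and imaginary parts of \<open>\<phi>0\<close> as test functions
    yields the integral of \<open>cnj \<phi> * \<phi>\<close>, that is of \<open>g\<close>.\<close>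
  have re: "continuous_on UNIV (\<lambda>s. Re (\<phi>0 s))" "\<And>s. \<bar>Re (\<phi>0 s)\<bar> \<le> cmod (\<phi>0 s)"
   and im: "continuous_on UNIV (\<lambda>s. Im (\<phi>0 s))" "\<And>s. \<bar>Im (\<phi>0 s)\<bar> \<le> cmod (\<phi>0 s)"
    using cont0 by (auto intro!: continuous_intros abs_Re_le_cmod abs_Im_le_cmod)
  have g_eq: "complex_of_real (g s) = complex_of_real (Re (\<phi>0 s) * exp (- real (2 * N) * s)) * \<phi> s
       - \<i> * (complex_of_real (Im (\<phi>0 s) * exp (- real (2 * N) * s)) * \<phi> s)" if "s \<in> {D<..}" for s
  proof -
    have "\<phi> s = \<phi>0 s" using that by (simp add: \<phi>0_def)
    moreover have "complex_of_real ((cmod w)\<^sup>2) = complex_of_real (Re w) * w - \<i> * (complex_of_real (Im w) * w)" for w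
      unfolding cmod_power2 by (simp add: complex_eq_iff) (simp add: power2_eq_square)
    ultimately show ?thesis
      unfolding g_def of_real_mult by (simp only:) (simp add: algebra_simps)
  qed
  note ints = set_integral_diff[OF comp_int[OF re] set_integrable_mult_right[of \<i>, OF comp_int[OF im]]]
  have cg: "set_integrable lborel {D<..} (\<lambda>s. complex_of_real (g s))"
    using ints(1) by (subst set_integrable_cong[OF refl refl g_eq])
  have "(LINT s:{D<..}|lborel. complex_of_real (g s))
     = (LINT s:{D<..}|lborel. complex_of_real (Re (\<phi>0 s) * exp (- real (2 * N) * s)) * \<phi> s
       - \<i> * (complex_of_real (Im (\<phi>0 s) * exp (- real (2 * N) * s)) * \<phi> s))"
    by (intro set_lebesgue_integral_cong allI impI g_eq) simp
  also have "\<dots> = 0"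
    unfolding ints(2) set_integral_mult_right weight[OF re] weight[OF im] by simp
  finally have "(LINT s:{D<..}|lborel. complex_of_real (g s)) = 0" .
  then have g0: "(LINT s:{D<..}|lborel. g s) = 0"
    by (simp add: set_integral_complex_of_real)
  have "\<bar>g s\<bar> = g s" for s by (simp add: g_def)
  then have g_int: "set_integrable lborel {D<..} g"
    using set_integrable_norm[OF cg] by simp
  \<comment> \<open>A nonnegative function with zero integral vanishes almost everywhere; since the
    zero set of \<open>g\<close> is closed, it then contains the whole open half-line.\<close>
  have "AE s in lborel. indicator {D<..} s *\<^sub>R g s = 0"
    using g0 g_int unfolding set_lebesgue_integral_def set_integrable_def
    by (subst (asm) integral_nonneg_eq_0_iff_AE) (auto simp: g_def)
  then have "AE s in lborel. s \<in> {D<..} \<longrightarrow> s \<in> {s. g s = 0}"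
    by eventually_elim auto
  then have ae: "AE s\<in>{D<..} in lebesgue. s \<in> {s. g s = 0}"
    by (rule AE_completion)
  have "closed {s. g s = 0}"
    unfolding g_def by (intro closed_Collect_eq continuous_intros cont0)
  from mem_closed_if_AE_lebesgue_open[OF _ this ae, of s] s have "g s = 0" by simp
  then show ?thesis using s by (simp add: g_def \<phi>0_def)
qed

end

section \<open>Complex powers and monotone fluxes\<close>

text \<open>A nondecreasing \<open>Q\<close> that comes arbitrarily close to zero towards both ends
  must be zero: a positive value would persist to the right, a negative one to the left. Smallness
  is asked for at points beyond each \<open>x\<close>, so that the bounded angular interval and the
  unbounded radial one are both covered.\<close>

lemma flux_derivative_eq_0:
  fixes Q Q' :: "real \<Rightarrow> real"
  assumes "open I" "convex I" and der: "\<And>x. x \<in> I \<Longrightarrow> (Q has_real_derivative Q' x) (at x)"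
    and nonneg: "\<And>x. x \<in> I \<Longrightarrow> 0 \<le> Q' x"
    and lo: "\<And>x e. x \<in> I \<Longrightarrow> 0 < e \<Longrightarrow> \<exists>y\<in>I. y < x \<and> \<bar>Q y\<bar> < e"
    and hi: "\<And>x e. x \<in> I \<Longrightarrow> 0 < e \<Longrightarrow> \<exists>y\<in>I. x < y \<and> \<bar>Q y\<bar> < e"
    and x: "x \<in> I"
  shows "Q' x = 0"
proof -
  have mono: "Q y \<le> Q z" if "y \<in> I" "z \<in> I" "y \<le> z" for y z
  proof (rule DERIV_nonneg_imp_nondecreasing[OF that(3)])
    fix t assume "y \<le> t" "t \<le> z"
    then have "t \<in> I"
      using that \<open>convex I\<close> by (meson is_interval_convex_1 mem_is_interval_1_I)
    then show "\<exists>d. (Q has_real_derivative d) (at t) \<and> 0 \<le> d"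
      using der nonneg by blast
  qed
  have Q0: "Q y = 0" if y: "y \<in> I" for y
  proof (rule ccontr)
    assume "Q y \<noteq> 0"
    then consider "0 < Q y" | "Q y < 0" by linarith
    then show False
    proof cases
      case 1
      then obtain z where "z \<in> I" "y < z" "\<bar>Q z\<bar> < Q y" using hi[OF y] by blast
      then show False using mono[OF y, of z] by linarith
    next
      case 2
      then obtain z where "z \<in> I" "z < y" "\<bar>Q z\<bar> < - Q y" using lo[OF y, of "- Q y"] by auto
      then show False using mono[OF _ y, of z] by linarith
    qed
  qed
  have "((\<lambda>_. 0) has_real_derivative Q' x) (at x)"
    by (rule has_field_derivative_transform_within_open[OF der[OF x] \<open>open I\<close> x Q0])
  then show ?thesis by (rule DERIV_unique) simp
qed

section \<open>Complex powers of positive reals and growth comparisons\<close>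

lemma norm_rcpow: "cmod (rcpow x p) = exp (Re p * ln x)"
  by (simp add: rcpow_def)

lemma rcpow_nonzero: "rcpow x p \<noteq> 0"
  by (simp add: rcpow_def)

lemma rcpow_minus_mult: "rcpow x p * (rcpow x (- p) * w) = w"
  by (simp add: rcpow_def exp_minus)

lemma rcpow_has_vector_derivative:
  assumes "0 < x"
  shows "((\<lambda>x. rcpow x p) has_vector_derivative p / of_real x * rcpow x p) (at x)"
proof -
  from has_vector_derivative_mult_right[OF has_vector_derivative_of_real[OF DERIV_ln_divide[OF assms]], of p]
  have "((\<lambda>x. p * complex_of_real (ln x)) has_vector_derivative p * of_real (1 / x)) (at x)" .
  from field_vector_diff_chain_at[OF this DERIV_exp] show ?thesis
    by (simp add: rcpow_def o_def)
qed

lemma rcpow_shift_has_vector_derivative: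
  assumes "D < x"
  shows "((\<lambda>x. rcpow (x - D) p) has_vector_derivative p / of_real (x - D) * rcpow (x - D) p) (at x)"
proof -
  have "((\<lambda>x. x - D) has_vector_derivative 1) (at x)"
    by (auto intro!: derivative_eq_intros simp flip: has_real_derivative_iff_has_vector_derivative)
  from vector_diff_chain_at[OF this rcpow_has_vector_derivative] assms show ?thesis
    by (simp add: o_def)
qed

lemma rcpow_tendsto_0:
  assumes "0 < Re p"
  shows "((\<lambda>x. rcpow (x - D) p) \<longlongrightarrow> 0) (at_right D)"
proof -
  have "((\<lambda>x. exp (Re p * ln x)) \<longlongrightarrow> 0) (at_right 0)"
    by (rule filterlim_compose[OF exp_at_bot])
       (use assms in \<open>auto intro!: filterlim_tendsto_pos_mult_at_bot[OF tendsto_const _ ln_at_0]\<close>)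
  then have "((\<lambda>x. cmod (rcpow x p)) \<longlongrightarrow> 0) (at_right 0)"
    by (simp add: norm_rcpow)
  then have "((\<lambda>x. cmod (rcpow (x - D) p)) \<longlongrightarrow> 0) (at_right D)"
    by (subst at_right_to_0) (simp add: filterlim_filtermap)
  then show ?thesis by (rule tendsto_norm_zero_cancel)
qed

text \<open>In exponentiated form, any power of \<open>x\<close> on \<open>{D<..}\<close> is
  absorbed by an exponential of arbitrarily small rate.\<close>

lemma mult_ln_le_linear:
  fixes k e D :: real
  assumes "0 < D" "0 < e"
  obtains K where "\<And>x. D < x \<Longrightarrow> k * ln x \<le> K + e * x"
proof (cases "0 < k")
  case True
  have "k * ln x \<le> k * ln (k / e) + e * x" if "D < x" for x
  proof -
    have "0 < x" using that assms by simp
    then have "ln x = ln (e * x / k) + ln (k / e)"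
      using True assms by (simp add: ln_mult ln_div)
    moreover have "ln (e * x / k) \<le> e * x / k"
      using True assms \<open>0 < x\<close> by (intro order_trans[OF ln_le_minus_one]) auto
    ultimately have "k * ln x \<le> k * (e * x / k + ln (k / e))"
      using True by (intro mult_left_mono) auto
    then show ?thesis using True by (simp add: algebra_simps)
  qed
  then show ?thesis by (rule that)
next
  case False
  have "k * ln x \<le> k * ln D + e * x" if "D < x" for x
  proof -
    have "k * ln x \<le> k * ln D"
      using False assms that by (intro mult_left_mono_neg) auto
    then show ?thesis using assms that by (simp add: add_increasing2)
  qed
  then show ?thesis by (rule that)
qed

lemma power_mult_exp_tendsto_0:
  fixes d :: real
  assumes "0 < d"
  shows "((\<lambda>s. s ^ k * exp (- d * s)) \<longlongrightarrow> 0) at_top"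
proof (rule Lim_null_comparison)
  have "filterlim (\<lambda>s. - (d / 2) * s) at_bot at_top"
    using assms by (intro filterlim_tendsto_neg_mult_at_bot[OF tendsto_const] filterlim_ident) auto
  then have "((\<lambda>s. exp (- (d / 2) * s)) \<longlongrightarrow> 0) at_top"
    by (rule filterlim_compose[OF exp_at_bot])
  then show "((\<lambda>s. fact k / (d / 2) ^ k * exp (- (d / 2) * s)) \<longlongrightarrow> 0) at_top"
    by (rule tendsto_mult_right_zero)
  have "norm (s ^ k * exp (- d * s)) \<le> fact k / (d / 2) ^ k * exp (- (d / 2) * s)" if "0 \<le> s" for s
  proof -
    have "(d / 2 * s) ^ k \<le> fact k * exp (d / 2 * s)"
      using assms that by (intro power_le_fact_exp) auto
    then have "s ^ k \<le> fact k / (d / 2) ^ k * exp (d / 2 * s)"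
      using assms by (simp add: field_simps power_mult_distrib)
    then have "s ^ k * exp (- d * s) \<le> fact k / (d / 2) ^ k * exp (d / 2 * s) * exp (- d * s)"
      by (rule mult_right_mono) simp
    also have "\<dots> = fact k / (d / 2) ^ k * (exp (d / 2 * s) * exp (- d * s))" by simp
    also have "exp (d / 2 * s) * exp (- d * s) = exp (- (d / 2) * s)"
      by (simp add: exp_add [symmetric] field_simps)
    finally show ?thesis using that by simp
  qed
  then show "\<forall>\<^sub>F s in at_top. norm (s ^ k * exp (- d * s)) \<le> fact k / (d / 2) ^ k * exp (- (d / 2) * s)"
    by (intro eventually_mono[OF eventually_ge_at_top[of 0]])
qed

lemma tendsto_0_mult_bounded:
  fixes f g :: "real \<Rightarrow> complex"
  assumes "(f \<longlongrightarrow> 0) F" "eventually (\<lambda>x. cmod (g x) \<le> K) F"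
  shows "((\<lambda>x. f x * g x) \<longlongrightarrow> 0) F"
proof (rule Lim_null_comparison)
  show "((\<lambda>x. cmod (f x) * K) \<longlongrightarrow> 0) F"
    using assms(1) by (intro tendsto_mult_left_zero tendsto_norm_zero)
  show "\<forall>\<^sub>F x in F. cmod (f x * g x) \<le> cmod (f x) * K"
    using assms(2) by eventually_elim (simp add: norm_mult mult_left_mono)
qed

text \<open>Used with \<open>c = cnj \<nu>\<close> and \<open>g\<close> the weighted derivative of
  \<open>f\<close>, for the angular and for the transformed radial equation alike.\<close>

lemma flux_has_real_derivative:
  assumes "(f has_vector_derivative f') (at x)" "(g has_vector_derivative g') (at x)"
  shows "((\<lambda>x. Re (c * g x * cnj (f x))) has_real_derivative Re (c * (g' * cnj (f x) + g x * cnj f'))) (at x)"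
proof -
  have "((\<lambda>x. cnj (f x)) has_vector_derivative cnj f') (at x)"
    by (rule bounded_linear.has_vector_derivative[OF bounded_linear_cnj assms(1)])
  from has_vector_derivative_mult_right[OF has_vector_derivative_mult[OF assms(2) this], of c]
  have "((\<lambda>x. Re (c * (g x * cnj (f x)))) has_vector_derivative Re (c * (g x * cnj f' + g' * cnj (f x)))) (at x)"
    by (rule bounded_linear.has_vector_derivative[OF bounded_linear_Re])
  then show ?thesis
    by (simp add: has_real_derivative_iff_has_vector_derivative mult.assoc add.commute)
qed

text \<open>The dictionary is \<open>x = z\<close>, \<open>y = z - D\<close>,
  \<open>A = 2 \<nu> / D\<close>, \<open>p = A * x - \<nu>\<close>, with \<open>m\<close> the mass
  \<open>M\<close> and \<open>t0\<close>, \<open>t1\<close>, \<open>t2\<close> the moments at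
  \<open>p\<close>. The left side is the derivative of \<open>P'\<close> divided by
  \<open>\<sigma>\<close>, the right side is \<open>- W' * t0\<close>. The leading coefficient
  \<open>p^2 - \<nu>^2\<close> becomes \<open>A^2 * x * y\<close>, which explains the choice of
  \<open>A\<close>.\<close>

lemma transformed_ode_algebra:
  fixes A x y m \<nu> \<eta> \<kappa> t0 t1 t2 :: complex
  assumes y: "y \<noteq> 0" and \<nu>: "\<nu> = A * (x - y) / 2"
    and id: "((A * x - \<nu>)\<^sup>2 - \<nu>\<^sup>2) * t2
      + (- (x - y) * ((A * x - \<nu>)\<^sup>2 - \<nu>\<^sup>2) - 4 * m * \<nu> * (A * x - \<nu>) - 4 * m * \<nu>\<^sup>2 - 2 * (A * x - \<nu>)) * t1
      + (2 * (A * x - \<nu>) * \<eta> * (x - y) + (A * x - \<nu>) * (x - y) + \<kappa> + 4 * m\<^sup>2 * \<nu>\<^sup>2 + 2 * m * \<nu>) * t0 = 0"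
  defines "q \<equiv> 2 * m * \<nu> + \<nu> * y"
  shows "x * q * (- A * t1) + (q + x * \<nu>) * t0 - (x * y * A * (- A * t2) + (x + y) * A * t1)
      + (2 * m * \<nu> / y + \<nu>) * (x * q * t0 - x * y * A * t1)
    = - (- \<nu>\<^sup>2 * (x * y) - 4 * m\<^sup>2 * \<nu>\<^sup>2 * x / y
     + (4 * \<nu> * \<eta> - 4 * m * \<nu>\<^sup>2) * x - 2 * \<nu> * \<eta> * (x - y) + \<kappa> + 4 * m\<^sup>2 * \<nu>\<^sup>2) * t0"
proof -
  \<comment> \<open>Here \<open>h + \<nu>\<close> is the logarithmic derivative of
    \<open>\<sigma>\<close>; writing \<open>2 * m * \<nu>\<close> as \<open>h * y\<close> leaves
    identities between polynomials.\<close>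
  define h where "h = 2 * m * \<nu> / y"
  have n: "2 * m * \<nu> = h * y" using y by (simp add: h_def)
  have q: "q = (h + \<nu>) * y" unfolding q_def n by (simp add: algebra_simps)
  have n2: "4 * m * \<nu> = 2 * (h * y)" "4 * m * \<nu>\<^sup>2 = 2 * (h * y) * \<nu>" "4 * m\<^sup>2 * \<nu>\<^sup>2 = (h * y)\<^sup>2"
    unfolding n [symmetric] by (simp_all add: power2_eq_square)
  have n3: "4 * m\<^sup>2 * \<nu>\<^sup>2 * x / y = h\<^sup>2 * y * x"
    unfolding n2 using y by (simp add: power2_eq_square)
  define c0 c1 where "c0 = 2 * (A * x - \<nu>) * \<eta> * (x - y) + (A * x - \<nu>) * (x - y) + \<kappa> + (h * y)\<^sup>2 + h * y"
    and "c1 = - (x - y) * (A\<^sup>2 * x * y) - 2 * (h * y) * (A * x - \<nu>) - 2 * (h * y) * \<nu> - 2 * (A * x - \<nu>)"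
  have "(A * x - \<nu>)\<^sup>2 - \<nu>\<^sup>2 = A\<^sup>2 * x * y"
    unfolding \<nu> by (simp add: field_simps power2_eq_square)
  with id have "A\<^sup>2 * x * y * t2 + c1 * t1 + c0 * t0 = 0"
    unfolding c0_def c1_def n n2 by simp
  then have t2_eq: "A\<^sup>2 * x * y * t2 = - c1 * t1 - c0 * t0"
    by algebra
  have k1: "- (x * q * A) - (x + y) * A - (h + \<nu>) * (x * y * A) = c1"
    unfolding q c1_def \<nu> by (simp add: field_simps power2_eq_square)
  have k0: "q + x * \<nu> + (h + \<nu>) * (x * q) - c0 = - (- \<nu>\<^sup>2 * (x * y) - h\<^sup>2 * y * x
     + (4 * \<nu> * \<eta> - 2 * (h * y) * \<nu>) * x - 2 * \<nu> * \<eta> * (x - y) + \<kappa> + (h * y)\<^sup>2)"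
    unfolding q c0_def \<nu> by (simp add: field_simps power2_eq_square)
  have "x * q * (- A * t1) + (q + x * \<nu>) * t0 - (x * y * A * (- A * t2) + (x + y) * A * t1)
      + (h + \<nu>) * (x * q * t0 - x * y * A * t1)
    = A\<^sup>2 * x * y * t2 + (- (x * q * A) - (x + y) * A - (h + \<nu>) * (x * y * A)) * t1
      + (q + x * \<nu> + (h + \<nu>) * (x * q)) * t0"
    by (simp add: algebra_simps power2_eq_square)
  also have "\<dots> = (q + x * \<nu> + (h + \<nu>) * (x * q) - c0) * t0"
    unfolding t2_eq k1 by (simp add: algebra_simps)
  finally show ?thesis
    unfolding k0 h_def [symmetric] unfolding n3 unfolding n2 .
qed

section \<open>Whiting's transform\<close>

text \<open>\<open>P\<close> stands for \<open>s (s - D) R'\<close>, and \<open>W'\<close> is the potential of the transformed equation.\<close>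
locale whiting =
  fixes D M B :: real and \<nu> \<eta> \<xi> \<kappa> :: complex and R P :: "real \<Rightarrow> complex"
  assumes D_pos: "0 < D" and M_pos: "0 < M" and Re_\<nu>: "0 < Re \<nu>" and Re_\<xi>: "0 < Re \<xi>"
    and \<eta>_\<xi>: "\<eta> + \<xi> = 2 * of_real M * \<nu>"
    and R_deriv: "\<And>s. D < s \<Longrightarrow> (R has_vector_derivative P s / of_real (s * (s - D))) (at s)"
    and P_deriv: "\<And>s. D < s \<Longrightarrow> (P has_vector_derivative
      - (- \<nu>\<^sup>2 * of_real (s * (s - D)) - 4 * of_real M * \<nu>\<^sup>2 * of_real s + \<kappa>
         - \<xi>\<^sup>2 * of_real D / of_real (s - D) + \<eta>\<^sup>2 * of_real D / of_real s) * R s) (at s)"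
    and R_bound: "\<And>s. D < s \<Longrightarrow> cmod (R s) \<le> B"
    and P_bound: "\<And>s. D < s \<Longrightarrow> cmod (P s) \<le> B * (1 + s)"
begin

text \<open>Despite the prime, \<open>W'\<close>, \<open>R'\<close> and \<open>P'\<close> are not
  derivatives. There is no pole at \<open>z = 0\<close>, and the one at \<open>z = D\<close> has the
  indicial roots plus and minus \<open>2 M \<nu>\<close> in place of those involving the azimuthal
  number.\<close>

definition W' :: "real \<Rightarrow> complex" where
  "W' z = - \<nu>\<^sup>2 * of_real (z * (z - D)) - 4 * (of_real M)\<^sup>2 * \<nu>\<^sup>2 * of_real z / of_real (z - D)
     + (4 * \<nu> * \<eta> - 4 * of_real M * \<nu>\<^sup>2) * of_real z - 2 * \<nu> * \<eta> * of_real D + \<kappa> + 4 * (of_real M)\<^sup>2 * \<nu>\<^sup>2"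

text \<open>The part of the kernel that does not depend on \<open>p\<close>. Its exponents solve the
  indicial equations of \<open>R\<close> at the two finite singular points.\<close>

definition E :: "real \<Rightarrow> complex" where
  "E s = rcpow s \<eta> * rcpow (s - D) \<xi>"

definition \<phi> :: "real \<Rightarrow> complex" where
  "\<phi> s = E s * R s"

lemma B_nonneg: "0 \<le> B"
  using order_trans[OF norm_ge_zero R_bound[of "D + 1"]] by simp

lemma E_deriv:
  assumes "D < s"
  shows "(E has_vector_derivative (\<eta> / of_real s + \<xi> / of_real (s - D)) * E s) (at s)"
proof -
  have "0 < s" using assms D_pos by simp
  from has_vector_derivative_mult[OF rcpow_has_vector_derivative[OF this, of \<eta>] rcpow_shift_has_vector_derivative[OF assms, of \<xi>]]
  show ?thesis
    unfolding E_def by (rule has_vector_derivative_eq_rhs) (simp add: algebra_simps)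
qed

text \<open>Only half of the rate \<open>Re \<nu>\<close> is spent on the powers, so the transform
  converges in a neighbourhood of \<open>p = \<nu>\<close>, the parameter of the endpoint
  \<open>z = D\<close>.\<close>

lemma E_bound: obtains K where "\<And>s. D < s \<Longrightarrow> cmod (E s) \<le> K * exp (Re \<nu> / 2 * s)"
proof -
  have e: "0 < Re \<nu> / 4" using Re_\<nu> by simp
  obtain K1 where K1: "\<And>x. D < x \<Longrightarrow> Re \<eta> * ln x \<le> K1 + Re \<nu> / 4 * x"
    using mult_ln_le_linear[OF D_pos e] by blast
  obtain K2 where K2: "\<And>x. D < x \<Longrightarrow> Re \<xi> * ln x \<le> K2 + Re \<nu> / 4 * x"
    using mult_ln_le_linear[OF D_pos e] by blast
  have "cmod (E s) \<le> exp (K1 + K2) * exp (Re \<nu> / 2 * s)" if s: "D < s" for s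
  proof -
    have "ln (s - D) \<le> ln s" using s D_pos by simp
    then have "Re \<xi> * ln (s - D) \<le> Re \<xi> * ln s" using Re_\<xi> by simp
    then have "Re \<eta> * ln s + Re \<xi> * ln (s - D) \<le> (K1 + K2) + Re \<nu> / 2 * s"
      using K1[OF s] K2[OF s] by (simp add: algebra_simps)
    then show ?thesis
      by (simp add: E_def norm_mult norm_rcpow exp_add [symmetric])
  qed
  then show ?thesis by (rule that)
qed

lemma R_cont: "continuous_on {D<..} R"
  by (intro continuous_at_imp_continuous_on ballI)
     (metis R_deriv greaterThan_iff has_vector_derivative_continuous)

lemma E_cont: "continuous_on {D<..} E"
  by (intro continuous_at_imp_continuous_on ballI)
     (metis E_deriv greaterThan_iff has_vector_derivative_continuous)

lemma \<phi>_laplace_data: obtains C where "laplace_data D (Re \<nu> / 2) C \<phi>"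
proof -
  obtain K where K: "\<And>s. D < s \<Longrightarrow> cmod (E s) \<le> K * exp (Re \<nu> / 2 * s)" by (rule E_bound) blast
  have "laplace_data D (Re \<nu> / 2) (K * B) \<phi>"
  proof
    show "0 < D" by (rule D_pos)
    show "continuous_on {D<..} \<phi>"
      unfolding \<phi>_def by (intro continuous_intros E_cont R_cont)
    fix s assume s: "D < s"
    have "cmod (E s) * cmod (R s) \<le> (K * exp (Re \<nu> / 2 * s)) * B"
      using order_trans[OF norm_ge_zero K[OF s]] by (intro mult_mono K R_bound s) auto
    then show "cmod (\<phi> s) \<le> K * B * exp (Re \<nu> / 2 * s)"
      by (simp add: \<phi>_def norm_mult mult_ac)
  qed
  then show ?thesis by (rule that)
qed

lemma E_tendsto_0: "(E \<longlongrightarrow> 0) (at_right D)"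
proof -
  have "isCont (\<lambda>x. rcpow x \<eta>) D"
    using rcpow_has_vector_derivative[OF D_pos] by (rule has_vector_derivative_continuous)
  then have "((\<lambda>x. rcpow x \<eta>) \<longlongrightarrow> rcpow D \<eta>) (at_right D)"
    unfolding isCont_def by (rule filterlim_mono) (auto simp: at_le)
  from tendsto_mult[OF this rcpow_tendsto_0[OF Re_\<xi>]] show ?thesis
    by (simp add: E_def [abs_def])
qed

lemma \<phi>_tendsto_0: "(\<phi> \<longlongrightarrow> 0) (at_right D)"
  unfolding \<phi>_def
  by (rule tendsto_0_mult_bounded[OF E_tendsto_0, where K = B])
     (use R_bound in \<open>auto simp: eventually_at_filter\<close>)

text \<open>Green's identity moves the symmetric operator from \<open>R\<close> onto the kernel.
  There the poles cancel, since \<open>\<eta>\<close> and \<open>\<xi>\<close> contribute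
  \<open>- \<eta>^2 D / s\<close> and \<open>\<xi>^2 D / (s - D)\<close>, opposite to those of the
  potential. The quadratic in \<open>s\<close> that remains supplies the coefficients of the three
  moments.\<close>

lemma moment_identity:
  assumes p: "Re \<nu> / 2 < Re p"
  shows "(p\<^sup>2 - \<nu>\<^sup>2) * laplace_moment D \<phi> 2 p
    + (- of_real D * (p\<^sup>2 - \<nu>\<^sup>2) - 4 * of_real M * \<nu> * p - 4 * of_real M * \<nu>\<^sup>2 - 2 * p) * laplace_moment D \<phi> 1 p
    + (2 * p * \<eta> * of_real D + p * of_real D + \<kappa> + 4 * (of_real M)\<^sup>2 * \<nu>\<^sup>2 + 2 * of_real M * \<nu>) * laplace_moment D \<phi> 0 p = 0"
    (is "?c2 * _ + ?c1 * _ + ?c0 * _ = 0")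
proof -
  obtain C where "laplace_data D (Re \<nu> / 2) C \<phi>" by (rule \<phi>_laplace_data)
  then interpret laplace_data D "Re \<nu> / 2" C \<phi> .
  define H where "H s = E s * exp (- p * of_real s)" for s
  define b where "b s = \<eta> * of_real (s - D) + \<xi> * of_real s - p * of_real (s * (s - D))" for s
  define f where "f s = ?c2 * (of_real s ^ 2 * exp (- p * of_real s) * \<phi> s)
    + ?c1 * (of_real s ^ 1 * exp (- p * of_real s) * \<phi> s)
    + ?c0 * (of_real s ^ 0 * exp (- p * of_real s) * \<phi> s)" for s
  define N where "N s = H s * (b s * R s - P s)" for s
  \<comment> \<open>\<open>N\<close> is the Wronskian of \<open>R\<close> and the kernel \<open>H\<close>, because \<open>s (s - D) H' = b H\<close>.\<close>
  have N_deriv: "(N has_vector_derivative f s) (at s)" if s: "D < s" for s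
  proof -
    define x y where "x = complex_of_real s" and "y = complex_of_real (s - D)"
    have xy: "x \<noteq> 0" "y \<noteq> 0" "of_real D = x - y" "of_real (s * (s - D)) = x * y"
      using s D_pos by (auto simp: x_def y_def)
    have "((\<lambda>s. exp (- p * of_real s)) has_vector_derivative - p * exp (- p * x)) (at s)"
    proof -
      have "((\<lambda>s. - p * complex_of_real s) has_vector_derivative - p * of_real 1) (at s)"
        by (intro has_vector_derivative_mult_right has_vector_derivative_of_real DERIV_ident)
      from field_vector_diff_chain_at[OF this DERIV_exp] show ?thesis
        by (simp add: o_def x_def)
    qed
    from has_vector_derivative_mult[OF E_deriv[OF s] this]
    have H': "(H has_vector_derivative (\<eta> / x + \<xi> / y - p) * H s) (at s)"
      unfolding H_def by (rule has_vector_derivative_eq_rhs) (simp add: algebra_simps x_def y_def)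
    have "((\<lambda>s. \<eta> * complex_of_real (s - D) + \<xi> * of_real s - p * of_real (s * (s - D)))
        has_vector_derivative (\<eta> * of_real 1 + \<xi> * of_real 1 - p * of_real (2 * s - D))) (at s)"
      by (intro has_vector_derivative_add has_vector_derivative_diff has_vector_derivative_mult_right
          has_vector_derivative_of_real) (auto intro!: derivative_eq_intros)
    then have b': "(b has_vector_derivative (\<eta> + \<xi> - p * (x + y))) (at s)"
      unfolding b_def [abs_def] by (rule has_vector_derivative_eq_rhs) (simp add: x_def y_def)
    have b: "b s = \<eta> * y + \<xi> * x - p * (x * y)" by (simp add: b_def x_def y_def)
    from has_vector_derivative_mult[OF H' has_vector_derivative_diff[OF has_vector_derivative_mult[OF b' R_deriv[OF s]] P_deriv[OF s]]]
    show ?thesis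
      unfolding N_def
    proof (rule has_vector_derivative_eq_rhs)
      define m where "m = complex_of_real M"
      have \<xi>: "\<xi> = 2 * m * \<nu> - \<eta>" using \<eta>_\<xi> by (simp add: m_def algebra_simps)
      \<comment> \<open>\<open>q\<close> is the logarithmic derivative of \<open>H\<close> and
        \<open>w\<close> the potential; \<open>b = s (s - D) q\<close>, so
        \<open>q * b + b' + w\<close> is the operator applied to \<open>H\<close>, divided by
        \<open>H\<close>.\<close>
      define q w where "q = \<eta> / x + \<xi> / y - p"
        and "w = - \<nu>\<^sup>2 * (x * y) - 4 * m * \<nu>\<^sup>2 * x + \<kappa> - \<xi>\<^sup>2 * (x - y) / y + \<eta>\<^sup>2 * (x - y) / x"
      have "f s = H s * R s * (?c2 * x\<^sup>2 + ?c1 * x + ?c0)"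
        by (simp add: f_def \<phi>_def H_def x_def algebra_simps)
      also have "?c2 * x\<^sup>2 + ?c1 * x + ?c0 = q * b s + (\<eta> + \<xi> - p * (x + y)) + w"
        unfolding b xy(3) m_def [symmetric] \<xi> q_def w_def using xy(1,2)
        by (simp add: divide_simps) (simp add: algebra_simps power2_eq_square)
      finally have f: "f s = H s * R s * (q * b s + (\<eta> + \<xi> - p * (x + y)) + w)" .
      have bP: "b s * (P s / (x * y)) = q * P s"
        using xy(1,2) by (simp add: b q_def field_simps)
      show "H s * (b s * (P s / complex_of_real (s * (s - D))) + (\<eta> + \<xi> - p * (x + y)) * R s -
          - (- \<nu>\<^sup>2 * complex_of_real (s * (s - D)) - 4 * complex_of_real M * \<nu>\<^sup>2 * complex_of_real s + \<kappa>
            - \<xi>\<^sup>2 * complex_of_real D / complex_of_real (s - D) + \<eta>\<^sup>2 * complex_of_real D / complex_of_real s) * R s)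
          + (\<eta> / x + \<xi> / y - p) * H s * (b s * R s - P s) = f s"
        unfolding xy(3,4) m_def [symmetric] x_def [symmetric] y_def [symmetric] q_def [symmetric] w_def [symmetric] bP f
        by (simp add: algebra_simps)
    qed
  qed
  obtain K where K: "\<And>s. D < s \<Longrightarrow> cmod (E s) \<le> K * exp (Re \<nu> / 2 * s)" by (rule E_bound) blast
  have K0: "0 \<le> K" using order_trans[OF norm_ge_zero K[of "D + 1"]] by (simp add: zero_le_mult_iff)
  have G_bound: "cmod (b s * R s - P s) \<le> B * (cmod \<eta> + cmod \<xi> + cmod p + 1) * (1 + s) ^ 2" if s: "D < s" for s
  proof -
    have s0: "0 < s" "s - D \<le> s" using s D_pos by auto
    have "cmod (b s) \<le> cmod (\<eta> * of_real (s - D)) + cmod (\<xi> * of_real s) + cmod (p * of_real (s * (s - D)))"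
      unfolding b_def by (meson norm_triangle_ineq norm_triangle_ineq4 order_trans add_right_mono)
    also have "\<dots> = cmod \<eta> * (s - D) + cmod \<xi> * s + cmod p * (s * (s - D))"
      using s s0 by (simp only: norm_mult norm_of_real) simp
    also have "\<dots> \<le> cmod \<eta> * (1 + s) ^ 2 + cmod \<xi> * (1 + s) ^ 2 + cmod p * (1 + s) ^ 2"
    proof (intro add_mono mult_left_mono)
      show "s - D \<le> (1 + s) ^ 2" "s \<le> (1 + s) ^ 2"
        using s0 D_pos by (auto simp: power2_eq_square algebra_simps add_increasing)
      have "s * (s - D) \<le> s * s" using s0 by (intro mult_left_mono) auto
      also have "\<dots> \<le> (1 + s) ^ 2" using s0 by (simp add: power2_eq_square algebra_simps)
      finally show "s * (s - D) \<le> (1 + s) ^ 2" .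
    qed auto
    finally have b: "cmod (b s) \<le> (cmod \<eta> + cmod \<xi> + cmod p) * (1 + s) ^ 2" by (simp add: algebra_simps)
    have "cmod (b s * R s) \<le> (cmod \<eta> + cmod \<xi> + cmod p) * (1 + s) ^ 2 * B"
      unfolding norm_mult using b R_bound[OF s] by (intro mult_mono) auto
    moreover have "cmod (P s) \<le> B * (1 + s) ^ 2"
      using P_bound[OF s] s0 B_nonneg
      by (intro order_trans[OF P_bound[OF s]] mult_left_mono) (auto simp: power2_eq_square)
    ultimately show ?thesis
      using norm_triangle_ineq4[of "b s * R s" "P s"] by (simp add: algebra_simps)
  qed
  \<comment> \<open>At the horizon \<open>Re \<xi> > 0\<close> makes the kernel vanish, while
    \<open>b * R - P\<close> merely has to stay bounded.\<close>
  have lim_D: "(N \<longlongrightarrow> 0) (at_right D)"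
  proof -
    have "(H \<longlongrightarrow> 0) (at_right D)"
      unfolding H_def
    proof (rule tendsto_0_mult_bounded[OF E_tendsto_0])
      have "cmod (exp (- p * of_real s)) \<le> 1" if "D < s" for s
        using that D_pos p Re_\<nu> by simp
      then show "\<forall>\<^sub>F s in at_right D. cmod (exp (- p * of_real s)) \<le> 1"
        by (auto simp: eventually_at_filter)
    qed
    then show ?thesis
      unfolding N_def
    proof (rule tendsto_0_mult_bounded)
      have "cmod (b s * R s - P s) \<le> B * (cmod \<eta> + cmod \<xi> + cmod p + 1) * (2 + D) ^ 2" if "D < s" "s < D + 1" for s
        using that B_nonneg D_pos
        by (intro order_trans[OF G_bound[OF that(1)]] mult_left_mono power_mono) auto
      then show "\<forall>\<^sub>F s in at_right D. cmod (b s * R s - P s) \<le> B * (cmod \<eta> + cmod \<xi> + cmod p + 1) * (2 + D) ^ 2"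
        unfolding eventually_at_right_field by (intro exI[of _ "D + 1"]) auto
    qed
  qed
  have lim_top: "(N \<longlongrightarrow> 0) at_top"
  proof (rule Lim_null_comparison)
    define d where "d = Re p - Re \<nu> / 2"
    define L where "L = K * (B * (cmod \<eta> + cmod \<xi> + cmod p + 1) * 4)"
    have "0 < d" using p by (simp add: d_def)
    from power_mult_exp_tendsto_0[OF this, of 2]
    show "((\<lambda>s. L * (s\<^sup>2 * exp (- d * s))) \<longlongrightarrow> 0) at_top"
      by (rule tendsto_mult_right_zero)
    have "cmod (N s) \<le> L * (s\<^sup>2 * exp (- d * s))" if "D < s" "1 < s" for s
    proof -
      have "(1 + s) ^ 2 \<le> (2 * s) ^ 2" using that by (intro power_mono) auto
      then have "B * (cmod \<eta> + cmod \<xi> + cmod p + 1) * (1 + s) ^ 2 \<le> B * (cmod \<eta> + cmod \<xi> + cmod p + 1) * (2 * s) ^ 2"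
        using B_nonneg by (intro mult_left_mono) auto
      then have G: "cmod (b s * R s - P s) \<le> B * (cmod \<eta> + cmod \<xi> + cmod p + 1) * (4 * s\<^sup>2)"
        using G_bound[OF that(1)] by (simp add: power_mult_distrib)
      have "cmod (H s) \<le> K * exp (Re \<nu> / 2 * s) * exp (- Re p * s)"
        unfolding H_def norm_mult using K[OF that(1)] by (simp add: mult_right_mono)
      also have "\<dots> = K * exp (- d * s)"
        by (simp add: d_def exp_add [symmetric] algebra_simps)
      finally have "cmod (N s) \<le> K * exp (- d * s) * (B * (cmod \<eta> + cmod \<xi> + cmod p + 1) * (4 * s\<^sup>2))"
        unfolding N_def norm_mult using G K0 by (intro mult_mono) auto
      then show ?thesis unfolding L_def by (simp only: mult_ac)
    qed
    then show "\<forall>\<^sub>F s in at_top. cmod (N s) \<le> L * (s\<^sup>2 * exp (- d * s))"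
      by (intro eventually_mono[OF eventually_gt_at_top[of "max D 1"]]) auto
  qed
  note i = set_integrable_mult_right[of ?c2, OF set_integrable_moment[OF p, of 2]]
     set_integrable_mult_right[of ?c1, OF set_integrable_moment[OF p, of 1]]
     set_integrable_mult_right[of ?c0, OF set_integrable_moment[OF p, of 0]]
  have f_int: "set_integrable lborel {D<..} f"
    unfolding f_def by (intro set_integral_add(1) i)
  have "(LBINT s=ereal D..\<infinity>. f s) = 0 - 0"
  proof (rule interval_integral_FTC_integrable)
    show "(N has_vector_derivative f s) (at s)" if "ereal D < ereal s" for s using that N_deriv by simp
    show "isCont f s" if "ereal D < ereal s" for s
    proof -
      have "continuous_on {D<..} f"
        unfolding f_def by (intro continuous_intros cont)
      then show ?thesis using that by (simp add: continuous_on_eq_continuous_at)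
    qed
    show "set_integrable lborel (einterval (ereal D) \<infinity>) f"
      using f_int by (simp add: einterval_def greaterThan_def)
    show "((N \<circ> real_of_ereal) \<longlongrightarrow> 0) (at_right (ereal D))"
      using lim_D by (simp add: ereal_tendsto_simps)
    show "((N \<circ> real_of_ereal) \<longlongrightarrow> 0) (at_left \<infinity>)"
      using lim_top by (simp add: ereal_tendsto_simps)
  qed simp
  then have "(LINT s:{D<..}|lborel. f s) = 0"
    by (simp add: interval_integral_to_infinity_eq)
  moreover have "(LINT s:{D<..}|lborel. f s) = ?c2 * mom 2 p + ?c1 * mom 1 p + ?c0 * mom 0 p"
    unfolding f_def laplace_moment_def
    by (subst set_integral_add(2)[OF set_integral_add(1)[OF i(1,2)] i(3)], subst set_integral_add(2)[OF i(1,2)])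
       (simp only: set_integral_mult_right)
  ultimately show ?thesis by simp
qed

section \<open>The transformed solution, its equation and its behaviour at both ends\<close>

text \<open>The affine parameter sends \<open>z = 0\<close> and \<open>z = D\<close> to
  \<open>- \<nu>\<close> and \<open>\<nu>\<close>, the zeros of the coefficient
  \<open>p^2 - \<nu>^2\<close> of the second moment. The half-line \<open>z > D\<close> becomes the
  ray of multiples of \<open>\<nu>\<close> by reals above one.\<close>

definition T :: "nat \<Rightarrow> real \<Rightarrow> complex" where
  "T k z = laplace_moment D \<phi> k (2 * \<nu> / of_real D * of_real z - \<nu>)"

text \<open>The factor that puts the second-order equation of \<open>T 0\<close> into the divergence
  form \<open>(z (z - D) f')' + W' f = 0\<close>.\<close>

definition \<sigma> :: "real \<Rightarrow> complex" where
  "\<sigma> z = rcpow (z - D) (2 * of_real M * \<nu>) * exp (\<nu> * of_real z)"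

definition R' :: "real \<Rightarrow> complex" where
  "R' z = \<sigma> z * T 0 z"

text \<open>This is \<open>z (z - D)\<close> times the derivative of \<open>R'\<close>, with the
  pole of the logarithmic derivative of \<open>\<sigma>\<close> cancelled so that the limit at
  \<open>D\<close> can be read off.\<close>

definition P' :: "real \<Rightarrow> complex" where
  "P' z = \<sigma> z * (of_real z * (2 * of_real M * \<nu> + \<nu> * of_real (z - D)) * T 0 z
             - of_real (z * (z - D)) * (2 * \<nu> / of_real D) * T 1 z)"

lemma Re_param: "Re (2 * \<nu> / of_real D * of_real z - \<nu>) = Re \<nu> * (2 * z / D - 1)"
  by (simp add: field_simps)

lemma Re_param_gt:
  assumes "D \<le> z"
  shows "Re \<nu> / 2 < Re (2 * \<nu> / of_real D * of_real z - \<nu>)"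
proof -
  have "1 / 2 < 2 * z / D - 1" using assms D_pos by (simp add: field_simps)
  then have "Re \<nu> * (1 / 2) < Re \<nu> * (2 * z / D - 1)" using Re_\<nu> by (intro mult_strict_left_mono)
  then show ?thesis unfolding Re_param by simp
qed

lemma T_deriv:
  assumes "D \<le> z"
  shows "(T k has_vector_derivative - (2 * \<nu> / of_real D) * T (Suc k) z) (at z)"
proof -
  obtain C where "laplace_data D (Re \<nu> / 2) C \<phi>" by (rule \<phi>_laplace_data)
  then interpret laplace_data D "Re \<nu> / 2" C \<phi> .
  have "((\<lambda>z. 2 * \<nu> / of_real D * complex_of_real z - \<nu>) has_vector_derivative 2 * \<nu> / of_real D * of_real 1 - 0) (at z)"
    by (intro has_vector_derivative_diff has_vector_derivative_mult_right has_vector_derivative_of_real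
        DERIV_ident has_vector_derivative_const)
  from field_vector_diff_chain_at[OF this moment_has_field_derivative[OF Re_param_gt[OF assms]], of k]
  show ?thesis
    unfolding T_def [abs_def] o_def by (rule has_vector_derivative_eq_rhs) simp
qed

lemma \<sigma>_deriv:
  assumes "D < z"
  shows "(\<sigma> has_vector_derivative (2 * of_real M * \<nu> / of_real (z - D) + \<nu>) * \<sigma> z) (at z)"
proof -
  have "((\<lambda>z. exp (\<nu> * of_real z)) has_vector_derivative \<nu> * exp (\<nu> * of_real z)) (at z)"
  proof -
    have "((\<lambda>s. \<nu> * complex_of_real s) has_vector_derivative \<nu> * of_real 1) (at z)"
      by (intro has_vector_derivative_mult_right has_vector_derivative_of_real DERIV_ident)
    from field_vector_diff_chain_at[OF this DERIV_exp] show ?thesis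
      by (simp add: o_def)
  qed
  from has_vector_derivative_mult[OF rcpow_shift_has_vector_derivative[OF assms] this] show ?thesis
    unfolding \<sigma>_def [abs_def] by (rule has_vector_derivative_eq_rhs) (simp add: algebra_simps)
qed

lemma R'_deriv:
  assumes "D < z"
  shows "(R' has_vector_derivative P' z / of_real (z * (z - D))) (at z)"
proof -
  have "of_real z \<noteq> (0::complex)" "of_real (z - D) \<noteq> (0::complex)" using assms D_pos by auto
  with has_vector_derivative_mult[OF \<sigma>_deriv[OF assms] T_deriv[OF less_imp_le[OF assms], of 0]] show ?thesis
    unfolding R'_def [abs_def]
    by (elim has_vector_derivative_eq_rhs) (simp add: P'_def field_simps)
qed

lemma P'_deriv:
  assumes z: "D < z"
  shows "(P' has_vector_derivative - W' z * R' z) (at z)"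
proof -
  define x y m A where "x = complex_of_real z" and "y = complex_of_real (z - D)"
    and "m = complex_of_real M" and "A = 2 * \<nu> / of_real D"
  have D: "of_real D = x - y" by (simp add: x_def y_def)
  have nz: "x \<noteq> 0" "y \<noteq> 0" "x - y \<noteq> 0" using z D_pos unfolding D [symmetric] by (auto simp: x_def y_def)
  have \<nu>: "\<nu> = A * (x - y) / 2" using nz by (simp add: A_def D)
  have id: "((A * x - \<nu>)\<^sup>2 - \<nu>\<^sup>2) * T 2 z
    + (- (x - y) * ((A * x - \<nu>)\<^sup>2 - \<nu>\<^sup>2) - 4 * m * \<nu> * (A * x - \<nu>) - 4 * m * \<nu>\<^sup>2 - 2 * (A * x - \<nu>)) * T 1 z
    + (2 * (A * x - \<nu>) * \<eta> * (x - y) + (A * x - \<nu>) * (x - y) + \<kappa> + 4 * m\<^sup>2 * \<nu>\<^sup>2 + 2 * m * \<nu>) * T 0 z = 0"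
    using moment_identity[OF Re_param_gt[OF less_imp_le[OF z]]]
    unfolding T_def A_def [symmetric] x_def [symmetric] m_def [symmetric] unfolding D .
  have W': "W' z = - \<nu>\<^sup>2 * (x * y) - 4 * m\<^sup>2 * \<nu>\<^sup>2 * x / y
     + (4 * \<nu> * \<eta> - 4 * m * \<nu>\<^sup>2) * x - 2 * \<nu> * \<eta> * (x - y) + \<kappa> + 4 * m\<^sup>2 * \<nu>\<^sup>2"
  proof -
    have "complex_of_real (z * (z - D)) = x * y" by (simp add: x_def y_def)
    then show ?thesis
      unfolding W'_def D m_def [symmetric] x_def [symmetric] y_def [symmetric] by simp
  qed
  have T': "(T 0 has_vector_derivative - A * T 1 z) (at z)" "(T 1 has_vector_derivative - A * T 2 z) (at z)"
    using T_deriv[of z 0] T_deriv[of z 1] z by (simp_all add: A_def numeral_2_eq_2)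
  have 1: "((\<lambda>z. complex_of_real z * (2 * m * \<nu> + \<nu> * of_real (z - D))) has_vector_derivative
      (2 * m * \<nu> + \<nu> * y) + x * \<nu>) (at z)"
  proof -
    have "((\<lambda>z. 2 * m * \<nu> + \<nu> * complex_of_real (z - D)) has_vector_derivative 0 + \<nu> * of_real 1) (at z)"
      by (intro has_vector_derivative_add has_vector_derivative_mult_right has_vector_derivative_of_real
          has_vector_derivative_const) (auto intro!: derivative_eq_intros)
    from has_vector_derivative_mult[OF has_vector_derivative_of_real[OF DERIV_ident] this]
    show ?thesis by (rule has_vector_derivative_eq_rhs) (simp add: x_def y_def)
  qed
  have 2: "((\<lambda>z. complex_of_real (z * (z - D)) * A) has_vector_derivative (x + y) * A) (at z)"
  proof -
    have "((\<lambda>z. complex_of_real (z * (z - D))) has_vector_derivative of_real (2 * z - D)) (at z)"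
      by (intro has_vector_derivative_of_real) (auto intro!: derivative_eq_intros)
    from has_vector_derivative_mult_left[OF this, of A]
    show ?thesis by (rule has_vector_derivative_eq_rhs) (simp add: x_def y_def)
  qed
  note d = has_vector_derivative_mult[OF \<sigma>_deriv[OF z]
      has_vector_derivative_diff[OF has_vector_derivative_mult[OF 1 T'(1)] has_vector_derivative_mult[OF 2 T'(2)]]]
  show ?thesis
    unfolding P'_def [abs_def] m_def [symmetric] A_def [symmetric]
    using d
  proof (rule has_vector_derivative_eq_rhs)
    note main = transformed_ode_algebra[OF nz(2) \<nu> id, folded W']
    show "\<sigma> z * (complex_of_real z * (2 * m * \<nu> + \<nu> * complex_of_real (z - D)) * (- A * T 1 z)
        + (2 * m * \<nu> + \<nu> * y + x * \<nu>) * T 0 z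
        - (complex_of_real (z * (z - D)) * A * (- A * T 2 z) + (x + y) * A * T 1 z))
        + (2 * complex_of_real M * \<nu> / complex_of_real (z - D) + \<nu>) * \<sigma> z *
          (complex_of_real z * (2 * m * \<nu> + \<nu> * complex_of_real (z - D)) * T 0 z - complex_of_real (z * (z - D)) * A * T 1 z)
        = - W' z * R' z"
    proof -
      have xy: "complex_of_real (z * (z - D)) = x * y" by (simp add: x_def y_def)
      have R: "- W' z * R' z = \<sigma> z * (- W' z * T 0 z)" by (simp add: R'_def)
      have "\<sigma> z * a + g * \<sigma> z * b = \<sigma> z * (a + g * b)" for a b g by (simp add: algebra_simps)
      then show ?thesis
        unfolding R main [symmetric] xy x_def [symmetric] y_def [symmetric] m_def [symmetric] .
    qed
  qed
qed

text \<open>The power in \<open>\<sigma>\<close> has exponent of real part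
  \<open>2 M Re \<nu> > 0\<close>, and the moments are continuous at \<open>z = D\<close> because
  \<open>\<nu>\<close> is interior to the half-plane of convergence.\<close>

lemma R'_P'_tendsto_0_at_D: "(R' \<longlongrightarrow> 0) (at_right D)" "(P' \<longlongrightarrow> 0) (at_right D)"
proof -
  have "((\<lambda>z. rcpow (z - D) (2 * of_real M * \<nu>)) \<longlongrightarrow> 0) (at_right D)"
    using M_pos Re_\<nu> by (intro rcpow_tendsto_0) simp
  moreover have "((\<lambda>z. exp (\<nu> * of_real z)) \<longlongrightarrow> exp (\<nu> * of_real D)) (at_right D)"
    by (intro tendsto_intros)
  ultimately have \<sigma>: "(\<sigma> \<longlongrightarrow> 0 * exp (\<nu> * of_real D)) (at_right D)"
    unfolding \<sigma>_def [abs_def] by (rule tendsto_mult)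
  have T: "(T k \<longlongrightarrow> T k D) (at_right D)" for k
  proof -
    have "isCont (T k) D" by (rule has_vector_derivative_continuous[OF T_deriv]) simp
    then show ?thesis unfolding isCont_def by (rule filterlim_mono) (auto simp: at_le)
  qed
  show "(R' \<longlongrightarrow> 0) (at_right D)"
    unfolding R'_def [abs_def] by (rule tendsto_eq_rhs[OF tendsto_mult[OF \<sigma> T]]) simp
  show "(P' \<longlongrightarrow> 0) (at_right D)"
    unfolding P'_def [abs_def]
    by (rule tendsto_eq_rhs, rule tendsto_mult[OF \<sigma>], (rule tendsto_intros T)+) simp
qed

text \<open>The moments decay like \<open>exp (- 2 Re \<nu> z)\<close> because the integral starts
  at \<open>D\<close>. The exponential in \<open>\<sigma>\<close> uses up half of that, its power is
  absorbed by a further \<open>Re \<nu> / 2\<close>, and the rest kills all polynomial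
  factors.\<close>

lemma R'_P'_tendsto_0_at_top: "(R' \<longlongrightarrow> 0) at_top" "(P' \<longlongrightarrow> 0) at_top"
proof -
  obtain C where "laplace_data D (Re \<nu> / 2) C \<phi>" by (rule \<phi>_laplace_data)
  then interpret laplace_data D "Re \<nu> / 2" C \<phi> .
  obtain K where K: "\<And>x. D < x \<Longrightarrow> 2 * M * Re \<nu> * ln x \<le> K + Re \<nu> / 2 * x"
    using mult_ln_le_linear[OF D_pos, of "Re \<nu> / 2" "2 * M * Re \<nu>"] Re_\<nu> by auto
  have U: "((\<lambda>z. complex_of_real z ^ j * (\<sigma> z * T k z)) \<longlongrightarrow> 0) at_top" for j k
  proof (rule Lim_null_comparison)
    define J where "J = (LINT s:{D<..}|lborel. s ^ k * exp (- Re \<nu> * s) * cmod (\<phi> s))"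
    define L where "L = exp (K + 2 * Re \<nu> * D) * J"
    show "((\<lambda>z. L * (z ^ j * exp (- (Re \<nu> / 2) * z))) \<longlongrightarrow> 0) at_top"
      using Re_\<nu> by (intro tendsto_mult_right_zero power_mult_exp_tendsto_0) simp
    have "cmod (complex_of_real z ^ j * (\<sigma> z * T k z)) \<le> L * (z ^ j * exp (- (Re \<nu> / 2) * z))" if z: "D < z" for z
    proof -
      have z0: "0 < z" using z D_pos by simp
      have "1 \<le> 2 * z / D - 1" using z D_pos by (simp add: field_simps)
      then have "Re \<nu> * 1 \<le> Re \<nu> * (2 * z / D - 1)" using Re_\<nu> by (intro mult_left_mono) auto
      then have "cmod (T k z) \<le> exp (- (Re \<nu> * (2 * z / D - 1) - Re \<nu>) * D) * J"
        using norm_moment_le[of \<nu> "2 * \<nu> / of_real D * of_real z - \<nu>" k] Re_\<nu>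
        unfolding Re_param T_def J_def by simp
      also have "- (Re \<nu> * (2 * z / D - 1) - Re \<nu>) * D = 2 * Re \<nu> * D - 2 * Re \<nu> * z"
        using D_pos by (simp add: field_simps)
      finally have T: "cmod (T k z) \<le> exp (2 * Re \<nu> * D - 2 * Re \<nu> * z) * J" .
      have "ln (z - D) \<le> ln z" using z D_pos by simp
      then have "2 * M * Re \<nu> * ln (z - D) \<le> 2 * M * Re \<nu> * ln z"
        using M_pos Re_\<nu> by (intro mult_left_mono) auto
      then have "2 * M * Re \<nu> * ln (z - D) + Re \<nu> * z \<le> K + Re \<nu> * 3 / 2 * z"
        using K[OF z] by (simp add: algebra_simps)
      then have "cmod (\<sigma> z) \<le> exp (K + Re \<nu> * 3 / 2 * z)"
        by (simp add: \<sigma>_def norm_mult norm_rcpow exp_add [symmetric])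
      then have "cmod (\<sigma> z) * cmod (T k z) \<le> exp (K + Re \<nu> * 3 / 2 * z) * (exp (2 * Re \<nu> * D - 2 * Re \<nu> * z) * J)"
        using T by (intro mult_mono) auto
      also have "\<dots> = (exp (K + Re \<nu> * 3 / 2 * z) * exp (2 * Re \<nu> * D - 2 * Re \<nu> * z)) * J" by simp
      also have "exp (K + Re \<nu> * 3 / 2 * z) * exp (2 * Re \<nu> * D - 2 * Re \<nu> * z) = exp (K + 2 * Re \<nu> * D) * exp (- (Re \<nu> / 2) * z)"
        by (simp only: exp_add [symmetric]) (simp add: algebra_simps)
      finally have "z ^ j * (cmod (\<sigma> z) * cmod (T k z)) \<le> z ^ j * (exp (K + 2 * Re \<nu> * D) * exp (- (Re \<nu> / 2) * z) * J)"
        using z0 by (intro mult_left_mono) auto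
      then show ?thesis using z0 by (simp add: L_def norm_mult norm_power mult_ac)
    qed
    then show "\<forall>\<^sub>F z in at_top. cmod (complex_of_real z ^ j * (\<sigma> z * T k z)) \<le> L * (z ^ j * exp (- (Re \<nu> / 2) * z))"
      by (intro eventually_mono[OF eventually_gt_at_top[of D]])
  qed
  show "(R' \<longlongrightarrow> 0) at_top"
    using U[of 0 0] by (simp add: R'_def [abs_def])
  define A where "A = 2 * \<nu> / of_real D"
  have "((\<lambda>z. (2 * of_real M * \<nu> - \<nu> * of_real D) * (of_real z ^ 1 * (\<sigma> z * T 0 z)) + \<nu> * (of_real z ^ 2 * (\<sigma> z * T 0 z))
      - A * (of_real z ^ 2 * (\<sigma> z * T 1 z)) + A * of_real D * (of_real z ^ 1 * (\<sigma> z * T 1 z))) \<longlongrightarrow> 0) at_top"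
    by (rule tendsto_eq_rhs, (rule tendsto_add tendsto_diff tendsto_mult tendsto_const U)+) simp
  then show "(P' \<longlongrightarrow> 0) at_top"
    unfolding P'_def [abs_def] A_def [symmetric]
    by (rule Lim_transform_eventually) (simp add: algebra_simps power2_eq_square)
qed

text \<open>Both summands of the flux derivative \<open>Q'\<close> are nonnegative and their sum
  vanishes; the potential term is strictly positive unless \<open>R' z = 0\<close>, and
  \<open>\<sigma>\<close> has no zeros.\<close>

lemma T_0_eq_0:
  assumes neg: "\<And>z. D < z \<Longrightarrow> Re (cnj \<nu> * W' z) < 0" and z: "D < z"
  shows "T 0 z = 0"
proof -
  define Q where "Q z = Re (cnj \<nu> * P' z * cnj (R' z))" for z
  define Q' where "Q' z = - Re (cnj \<nu> * W' z) * (cmod (R' z))\<^sup>2 + Re \<nu> * (cmod (P' z))\<^sup>2 / (z * (z - D))" for z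
  have Q0: "(Q \<longlongrightarrow> 0) F" if "(R' \<longlongrightarrow> 0) F" "(P' \<longlongrightarrow> 0) F" for F
    unfolding Q_def
    by (rule tendsto_eq_rhs[OF tendsto_Re[OF tendsto_mult[OF tendsto_mult[OF tendsto_const that(2)] tendsto_cnj[OF that(1)]]]]) simp
  have "Q' z = 0"
  proof (rule flux_derivative_eq_0[where I = "{D<..}" and Q = Q and Q' = Q' and x = z])
    fix x assume "x \<in> {D<..}"
    then have x: "D < x" by simp
    have "Re (cnj \<nu> * ((- W' x * R' x) * cnj (R' x) + P' x * cnj (P' x / of_real (x * (x - D))))) = Q' x"
    proof -
      have "cnj \<nu> * ((- W' x * R' x) * cnj (R' x) + P' x * cnj (P' x / of_real (x * (x - D))))
        = - (cnj \<nu> * W' x) * (R' x * cnj (R' x)) + cnj \<nu> * (P' x * cnj (P' x)) / of_real (x * (x - D))"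
        by (simp add: algebra_simps)
      also have "Re \<dots> = Q' x"
        unfolding complex_norm_square [symmetric] Q'_def
        by (simp add: Re_divide_of_real algebra_simps flip: of_real_power of_real_mult of_real_diff)
      finally show ?thesis .
    qed
    with flux_has_real_derivative[OF R'_deriv[OF x] P'_deriv[OF x], of "cnj \<nu>"]
    show "(Q has_real_derivative Q' x) (at x)" unfolding Q_def by simp
    show "0 \<le> Q' x"
      using neg[OF x] x D_pos Re_\<nu> unfolding Q'_def
      by (intro add_nonneg_nonneg mult_nonneg_nonneg divide_nonneg_nonneg) auto
    fix e :: real assume e: "0 < e"
    have "\<forall>\<^sub>F y in at_right D. \<bar>Q y\<bar> < e"
      using Q0[OF R'_P'_tendsto_0_at_D] e by (simp add: tendsto_iff)
    moreover have "\<forall>\<^sub>F y in at_right D. y \<in> {D<..<x}"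
      by (rule eventually_at_right_real[OF x])
    ultimately have "\<forall>\<^sub>F y in at_right D. y \<in> {D<..} \<and> y < x \<and> \<bar>Q y\<bar> < e"
      by eventually_elim auto
    then show "\<exists>y\<in>{D<..}. y < x \<and> \<bar>Q y\<bar> < e"
      using eventually_happens' by (metis (no_types, lifting) trivial_limit_at_right_real)
    have "\<forall>\<^sub>F y in at_top. \<bar>Q y\<bar> < e"
      using Q0[OF R'_P'_tendsto_0_at_top] e by (simp add: tendsto_iff)
    moreover have "\<forall>\<^sub>F y in at_top. x < y" by (rule eventually_gt_at_top)
    ultimately have "\<forall>\<^sub>F y in at_top. y \<in> {D<..} \<and> x < y \<and> \<bar>Q y\<bar> < e"
      by eventually_elim (use x in auto)
    then show "\<exists>y\<in>{D<..}. x < y \<and> \<bar>Q y\<bar> < e"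
      using eventually_happens' trivial_limit_at_top_linorder by (metis (no_types, lifting))
  qed (use z in auto)
  moreover have "0 \<le> Re \<nu> * (cmod (P' z))\<^sup>2 / (z * (z - D))"
    using z D_pos Re_\<nu> by simp
  moreover have "0 < - Re (cnj \<nu> * W' z)" using neg[OF z] by simp
  ultimately have "(cmod (R' z))\<^sup>2 = 0"
    unfolding Q'_def by (smt (verit) mult_pos_pos zero_le_power2)
  then show ?thesis
    by (simp add: R'_def \<sigma>_def rcpow_nonzero)
qed

theorem R_eq_0:
  assumes neg: "\<And>z. D < z \<Longrightarrow> Re (cnj \<nu> * W' z) < 0" and s: "D < s"
  shows "R s = 0"
proof -
  obtain C where "laplace_data D (Re \<nu> / 2) C \<phi>" by (rule \<phi>_laplace_data)
  then interpret laplace_data D "Re \<nu> / 2" C \<phi> .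
  define U where "U = (\<lambda>z. 2 * \<nu> / of_real D * complex_of_real z - \<nu>) ` {D<..}"
  have \<nu>: "\<nu> \<noteq> 0" using Re_\<nu> by auto
  \<comment> \<open>\<open>3 * \<nu>\<close> is the parameter of \<open>z = 2 * D\<close>. It is
    approached along the ray by \<open>z = 2 * D + h\<close>, with \<open>h\<close> chosen so that
    the distance is \<open>e / 2\<close>.\<close>
  have "3 * \<nu> islimpt U"
  proof (rule islimpt_approachable[THEN iffD2], intro allI impI)
    fix e :: real assume e: "0 < e"
    define h where "h = e * D / (4 * cmod \<nu>)"
    have h: "0 < h" using e D_pos \<nu> by (simp add: h_def)
    have eq: "2 * \<nu> / of_real D * complex_of_real (2 * D + h) - \<nu> - 3 * \<nu> = 2 * \<nu> / of_real D * of_real h"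
      using D_pos by (simp add: field_simps)
    have "cmod (2 * \<nu> / of_real D * of_real h) = e / 2"
      using D_pos h \<nu> e by (simp add: norm_mult norm_divide) (simp add: h_def)
    then have "dist (2 * \<nu> / of_real D * complex_of_real (2 * D + h) - \<nu>) (3 * \<nu>) = e / 2"
      unfolding dist_norm eq .
    moreover have "2 * \<nu> / of_real D * complex_of_real (2 * D + h) - \<nu> \<in> U"
      unfolding U_def by (rule imageI) (use D_pos h in simp)
    ultimately show "\<exists>x'\<in>U. x' \<noteq> 3 * \<nu> \<and> dist x' (3 * \<nu>) < e"
      using e by (metis dist_self half_gt_zero less_irrefl field_sum_of_halves less_add_same_cancel1)
  qed
  then have "mom 0 p = 0" if "Re \<nu> / 2 < Re p" for p
  proof (rule analytic_continuation[OF moment_holomorphic, rotated 4])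
    show "open {p. Re \<nu> / 2 < Re p}" by (rule open_halfspace_Re_gt)
    show "connected {p. Re \<nu> / 2 < Re p}" by (intro convex_connected convex_halfspace_Re_gt)
    show "U \<subseteq> {p. Re \<nu> / 2 < Re p}" using Re_param_gt by (auto simp: U_def)
    show "3 * \<nu> \<in> {p. Re \<nu> / 2 < Re p}" using Re_\<nu> by simp
    show "mom 0 w = 0" if "w \<in> U" for w
      using that T_0_eq_0[OF neg] by (auto simp: U_def T_def)
  qed (use that in auto)
  then have "\<phi> s = 0"
    using \<phi>_tendsto_0 s by (rule eq_0_if_moment_0_eq_0)
  then show ?thesis by (simp add: \<phi>_def E_def rcpow_nonzero)
qed

end

section \<open>Reduction of the mode equations\<close>

text \<open>Multiplied by \<open>cnj \<nu> * cnj S\<close>, the other terms of the angular equation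
  have real parts of one sign, because \<open>cnj \<nu> * \<nu>^2 = |\<nu>|^2 \<nu>\<close>. A
  negative \<open>Re (cnj \<nu> * lam)\<close> would make the flux
  \<open>sin \<theta> * S' * cnj S\<close>, weighted by \<open>cnj \<nu>\<close>, increase strictly
  wherever \<open>S\<close> is nonzero, although it vanishes at both poles of the sphere.\<close>

lemma Re_cnj_eigenvalue_nonneg:
  assumes "angular_eigenvalue a \<omega> m lam" and \<omega>: "0 < Im \<omega>"
  defines "\<nu> \<equiv> - \<i> * \<omega>"
  shows "0 \<le> Re (cnj \<nu> * lam)"
proof (rule ccontr)
  assume "\<not> 0 \<le> Re (cnj \<nu> * lam)"
  then have lam: "Re (cnj \<nu> * lam) < 0" by simp
  have Re_\<nu>: "0 < Re \<nu>" using \<omega> by (simp add: \<nu>_def)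
  from assms(1) obtain S where S: "angular_eigenfunction a \<omega> m lam S"
    unfolding angular_eigenvalue_def by blast
  then obtain \<theta>0 where \<theta>0: "\<theta>0 \<in> {0<..<pi}" "S \<theta>0 \<noteq> 0"
    unfolding angular_eigenfunction_def by blast
  from S obtain S1 T where ST: "\<forall>\<theta>\<in>{0<..<pi}. (S has_vector_derivative S1 \<theta>) (at \<theta>) \<and>
      ((\<lambda>t. complex_of_real (sin t) * S1 t) has_vector_derivative T \<theta>) (at \<theta>) \<and>
      T \<theta> / complex_of_real (sin \<theta>)
        - (complex_of_real ((of_int m)^2 / (sin \<theta>)^2) - (complex_of_real a)^2 * \<omega>^2 * complex_of_real ((cos \<theta>)^2)) * S \<theta>
        + lam * S \<theta> = 0"
    unfolding angular_eigenfunction_def by (elim conjE exE)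
  then have S1: "\<And>\<theta>. \<theta> \<in> {0<..<pi} \<Longrightarrow> (S has_vector_derivative S1 \<theta>) (at \<theta>)"
    and T: "\<And>\<theta>. \<theta> \<in> {0<..<pi} \<Longrightarrow> ((\<lambda>t. complex_of_real (sin t) * S1 t) has_vector_derivative T \<theta>) (at \<theta>)"
    and ode: "\<And>\<theta>. \<theta> \<in> {0<..<pi} \<Longrightarrow> T \<theta> / complex_of_real (sin \<theta>)
          - (complex_of_real ((of_int m)^2 / (sin \<theta>)^2) - (complex_of_real a)^2 * \<omega>^2 * complex_of_real ((cos \<theta>)^2)) * S \<theta>
          + lam * S \<theta> = 0"
    by blast+
  from S obtain F :: "real^3 \<Rightarrow> complex" where F: "smooth_on UNIV F"
    and FS: "\<And>\<theta> \<phi>. \<theta> \<in> {0<..<pi} \<Longrightarrow> F (vector [sin \<theta> * cos \<phi>, sin \<theta> * sin \<phi>, cos \<theta>])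
             = exp (\<i> * of_int m * complex_of_real \<phi>) * S \<theta>"
    unfolding angular_eigenfunction_def by (elim conjE exE) blast
  \<comment> \<open>The curve \<open>\<gamma>\<close> is the meridian \<open>\<phi> = 0\<close>,
    taken up to and including the poles. Along it \<open>S\<close> and \<open>S1\<close> extend
    continuously to \<open>{0..pi}\<close>, hence are bounded, so the factor
    \<open>sin \<theta>\<close> forces the flux to zero at the ends.\<close>
  define e1 e3 :: "real^3" where "e1 = vector [1, 0, 0]" and "e3 = vector [0, 0, 1]"
  define \<gamma> :: "real \<Rightarrow> real^3" where "\<gamma> \<theta> = sin \<theta> *\<^sub>R e1 + cos \<theta> *\<^sub>R e3" for \<theta>
  have S_eq: "S \<theta> = F (\<gamma> \<theta>)" if "\<theta> \<in> {0<..<pi}" for \<theta>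
  proof -
    have "\<gamma> \<theta> = vector [sin \<theta> * cos 0, sin \<theta> * sin 0, cos \<theta>]"
      by (simp add: vec_eq_iff forall_3 \<gamma>_def e1_def e3_def)
    then show ?thesis using FS[OF that, of 0] by simp
  qed
  from F have "Ck_on (Suc 0) UNIV F" unfolding smooth_on_def by blast
  then have Fd: "F differentiable_on UNIV" and Fc: "\<And>v. continuous_on UNIV (\<lambda>x. frechet_derivative F (at x) v)"
    by auto
  have FD: "(F has_derivative frechet_derivative F (at x)) (at x)" for x
    using Fd by (simp add: differentiable_on_def frechet_derivative_works [symmetric])
  have \<gamma>': "(\<gamma> has_vector_derivative (cos \<theta> *\<^sub>R e1 + - sin \<theta> *\<^sub>R e3)) (at \<theta>)" for \<theta>
    using has_vector_derivative_add[OF has_vector_derivative_scaleR[OF DERIV_sin has_vector_derivative_const[of e1]]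
        has_vector_derivative_scaleR[OF DERIV_cos has_vector_derivative_const[of e3]], of \<theta>]
    unfolding \<gamma>_def by simp
  have \<gamma>_cont: "continuous_on UNIV \<gamma>"
    unfolding \<gamma>_def by (intro continuous_intros)
  define G where "G \<theta> = cos \<theta> *\<^sub>R frechet_derivative F (at (\<gamma> \<theta>)) e1 - sin \<theta> *\<^sub>R frechet_derivative F (at (\<gamma> \<theta>)) e3" for \<theta>
  have S1_eq: "S1 \<theta> = G \<theta>" if \<theta>: "\<theta> \<in> {0<..<pi}" for \<theta>
  proof -
    have lin: "linear (frechet_derivative F (at (\<gamma> \<theta>)))"
      using FD has_derivative_linear by blast
    have "((F \<circ> \<gamma>) has_vector_derivative frechet_derivative F (at (\<gamma> \<theta>)) (cos \<theta> *\<^sub>R e1 + - sin \<theta> *\<^sub>R e3)) (at \<theta>)"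
      by (rule vector_derivative_diff_chain_within[of \<gamma> _ \<theta> UNIV F, simplified, OF \<gamma>' FD[THEN has_derivative_at_withinI]])
    then have "((F \<circ> \<gamma>) has_vector_derivative G \<theta>) (at \<theta>)"
      by (simp add: G_def linear_add[OF lin] linear_scale[OF lin] linear_diff[OF lin])
    then have "(S has_vector_derivative G \<theta>) (at \<theta>)"
      by (rule has_vector_derivative_transform_within_open[OF _ open_greaterThanLessThan \<theta>]) (simp add: S_eq)
    then show ?thesis using S1[OF \<theta>] vector_derivative_unique_at by blast
  qed
  have "continuous_on UNIV (\<lambda>\<theta>. frechet_derivative F (at (\<gamma> \<theta>)) v)" for v
    by (rule continuous_on_compose2[OF Fc \<gamma>_cont]) simp
  then have G_cont: "continuous_on {0..pi} G"
    unfolding G_def by (intro continuous_intros) (auto intro: continuous_on_subset)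
  have FG_cont: "continuous_on {0..pi} (\<lambda>\<theta>. F (\<gamma> \<theta>))"
    using continuous_on_compose2[OF differentiable_imp_continuous_on[OF Fd] \<gamma>_cont]
    by (auto intro: continuous_on_subset)
  obtain K1 where K1: "\<And>\<theta>. \<theta> \<in> {0..pi} \<Longrightarrow> cmod (G \<theta>) \<le> K1"
    using compact_imp_bounded[OF compact_continuous_image[OF G_cont compact_Icc]]
    unfolding bounded_iff by (metis imageI)
  obtain K2 where K2: "\<And>\<theta>. \<theta> \<in> {0..pi} \<Longrightarrow> cmod (F (\<gamma> \<theta>)) \<le> K2"
    using compact_imp_bounded[OF compact_continuous_image[OF FG_cont compact_Icc]]
    unfolding bounded_iff by (metis (no_types, lifting) imageI)
  define Q where "Q \<theta> = Re (cnj \<nu> * (complex_of_real (sin \<theta>) * S1 \<theta>) * cnj (S \<theta>))" for \<theta>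
  define Q' where "Q' \<theta> = sin \<theta> * ((((of_int m)\<^sup>2 / (sin \<theta>)\<^sup>2 + a\<^sup>2 * (cmod \<nu>)\<^sup>2 * (cos \<theta>)\<^sup>2) * Re \<nu> - Re (cnj \<nu> * lam)) * (cmod (S \<theta>))\<^sup>2
      + Re \<nu> * (cmod (S1 \<theta>))\<^sup>2)" for \<theta>
  have Q_bound: "\<bar>Q \<theta>\<bar> \<le> cmod \<nu> * K1 * K2 * sin \<theta>" if \<theta>: "\<theta> \<in> {0<..<pi}" for \<theta>
  proof -
    have s: "0 < sin \<theta>" using \<theta> sin_gt_zero by auto
    have "\<bar>Q \<theta>\<bar> \<le> cmod (cnj \<nu> * (complex_of_real (sin \<theta>) * S1 \<theta>) * cnj (S \<theta>))"
      unfolding Q_def by (rule abs_Re_le_cmod)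
    also have "\<dots> = cmod \<nu> * sin \<theta> * (cmod (G \<theta>) * cmod (F (\<gamma> \<theta>)))"
      using s \<theta> by (simp add: norm_mult S1_eq S_eq)
    also have "\<dots> \<le> cmod \<nu> * sin \<theta> * (K1 * K2)"
      using s \<theta> K1[of \<theta>] K2[of \<theta>] order_trans[OF norm_ge_zero K1[of \<theta>]]
      by (intro mult_left_mono mult_mono) auto
    finally show ?thesis by (simp add: mult_ac)
  qed
  have ends: "\<forall>\<^sub>F y in F. \<bar>Q y\<bar> < e" if "(sin \<longlongrightarrow> 0) F" "\<forall>\<^sub>F y in F. y \<in> {0<..<pi}" "0 < e" for F e
  proof -
    have "((\<lambda>\<theta>. cmod \<nu> * K1 * K2 * sin \<theta>) \<longlongrightarrow> 0) F"
      using that(1) by (rule tendsto_mult_right_zero)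
    then have "\<forall>\<^sub>F y in F. cmod \<nu> * K1 * K2 * sin y < e"
      using that(3) by (rule order_tendstoD(2))
    with that(2) show ?thesis
      by eventually_elim (use Q_bound in force)
  qed
  have sin_0: "(sin \<longlongrightarrow> 0) (at_right (0::real))" "(sin \<longlongrightarrow> 0) (at_left pi)"
    using tendsto_sin[OF tendsto_ident_at, of "0::real" "{0<..}"] tendsto_sin[OF tendsto_ident_at, of pi "{..<pi}"]
    by auto
  have coeff_pos: "0 < ((of_int m)\<^sup>2 / (sin \<theta>)\<^sup>2 + a\<^sup>2 * (cmod \<nu>)\<^sup>2 * (cos \<theta>)\<^sup>2) * Re \<nu> - Re (cnj \<nu> * lam)" for \<theta>
  proof -
    have "0 \<le> ((of_int m)\<^sup>2 / (sin \<theta>)\<^sup>2 + a\<^sup>2 * (cmod \<nu>)\<^sup>2 * (cos \<theta>)\<^sup>2) * Re \<nu>"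
      using Re_\<nu> by (intro mult_nonneg_nonneg add_nonneg_nonneg) auto
    then show ?thesis using lam by linarith
  qed
  have "Q' \<theta>0 = 0"
  proof (rule flux_derivative_eq_0[where I = "{0<..<pi}" and Q = Q and Q' = Q' and x = \<theta>0])
    fix x assume x: "x \<in> {0<..<pi}"
    have s: "0 < sin x" using x sin_gt_zero by auto
    have "T x = complex_of_real (sin x) * ((complex_of_real ((of_int m)^2 / (sin x)^2) - (complex_of_real a)^2 * \<omega>^2 * complex_of_real ((cos x)^2)) * S x - lam * S x)"
      using ode[OF x] s by (simp add: field_simps)
    also have "\<omega>\<^sup>2 = - \<nu>\<^sup>2" by (simp add: \<nu>_def power_mult_distrib)
    finally have T_eq: "T x = complex_of_real (sin x) * ((complex_of_real ((of_int m)^2 / (sin x)^2) + (complex_of_real a)^2 * \<nu>^2 * complex_of_real ((cos x)^2)) * S x - lam * S x)"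
      by simp
    have "cnj \<nu> * (T x * cnj (S x) + complex_of_real (sin x) * S1 x * cnj (S1 x))
      = complex_of_real (sin x) * ((complex_of_real ((of_int m)^2 / (sin x)^2) * cnj \<nu> + complex_of_real (a\<^sup>2 * (cos x)^2) * (\<nu> * cnj \<nu>) * \<nu> - cnj \<nu> * lam) * (S x * cnj (S x))
        + cnj \<nu> * (S1 x * cnj (S1 x)))"
      unfolding T_eq by (simp add: algebra_simps power2_eq_square)
    also have "Re \<dots> = Q' x"
    proof -
      define A B C E where "A = (of_int m)^2 / (sin x)^2" and "B = a\<^sup>2 * (cos x)^2"
        and "C = cnj \<nu> * lam" and "E = sin x"
      show ?thesis
        unfolding complex_norm_square [symmetric] Q'_def A_def [symmetric] C_def [symmetric] E_def [symmetric]
          B_def [symmetric]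
        by (simp flip: of_real_power of_real_mult) (simp add: B_def algebra_simps)
    qed
    finally have eq: "Re (cnj \<nu> * (T x * cnj (S x) + complex_of_real (sin x) * S1 x * cnj (S1 x))) = Q' x" .
    show "(Q has_real_derivative Q' x) (at x)"
      using flux_has_real_derivative[OF S1[OF x] T[OF x], of "cnj \<nu>"] unfolding eq Q_def .
    show "0 \<le> Q' x"
      unfolding Q'_def using Re_\<nu> s
      by (intro mult_nonneg_nonneg add_nonneg_nonneg less_imp_le[OF coeff_pos]) auto
    fix e :: real assume e: "0 < e"
    have "\<forall>\<^sub>F y in at_right 0. \<bar>Q y\<bar> < e"
      by (rule ends[OF sin_0(1) eventually_at_right_real[OF pi_gt_zero] e])
    moreover have "\<forall>\<^sub>F y in at_right 0. y \<in> {0<..<x}"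
      using x by (intro eventually_at_right_real) auto
    ultimately have "\<forall>\<^sub>F y in at_right 0. y \<in> {0<..<pi} \<and> y < x \<and> \<bar>Q y\<bar> < e"
      by eventually_elim (use x in auto)
    then show "\<exists>y\<in>{0<..<pi}. y < x \<and> \<bar>Q y\<bar> < e"
      using eventually_happens' by (metis (no_types, lifting) trivial_limit_at_right_real)
    have "\<forall>\<^sub>F y in at_left pi. \<bar>Q y\<bar> < e"
      by (rule ends[OF sin_0(2) eventually_at_left_real[OF pi_gt_zero] e])
    moreover have "\<forall>\<^sub>F y in at_left pi. y \<in> {x<..<pi}"
      using x by (intro eventually_at_left_real) auto
    ultimately have "\<forall>\<^sub>F y in at_left pi. y \<in> {0<..<pi} \<and> x < y \<and> \<bar>Q y\<bar> < e"
      by eventually_elim (use x in auto)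
    then show "\<exists>y\<in>{0<..<pi}. x < y \<and> \<bar>Q y\<bar> < e"
      using eventually_happens' by (metis (no_types, lifting) trivial_limit_at_left_real)
  qed (use \<theta>0 in auto)
  moreover have "0 < Q' \<theta>0"
  proof -
    have "0 < sin \<theta>0" using \<theta>0 sin_gt_zero by auto
    then show ?thesis
      unfolding Q'_def using Re_\<nu> \<theta>0(2)
      by (intro mult_pos_pos add_pos_nonneg coeff_pos) auto
  qed
  ultimately show False by simp
qed

section \<open>Normal form and a priori bounds for the radial equation\<close>

text \<open>First-order expansion over a unit step: \<open>u1 x\<close> differs from
  \<open>u (x + 1) - u x\<close> by at most \<open>B2\<close>. This controls \<open>u'\<close>
  without differentiating the expansion at infinity.\<close>

lemma derivative_bounded_if_second_derivative_bounded:
  fixes u :: "real \<Rightarrow> complex"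
  assumes u1: "\<And>x. (u has_vector_derivative u1 x) (at x)" and u2: "\<And>x. (u1 has_vector_derivative u2 x) (at x)"
    and B: "\<And>x. cmod (u x) \<le> B" and B2: "\<And>x. cmod (u2 x) \<le> B2"
  shows "cmod (u1 x) \<le> 2 * B + B2"
proof -
  have B2_0: "0 \<le> B2" using order_trans[OF norm_ge_zero B2] .
  have lip: "cmod (u1 y - u1 x) \<le> B2" if y: "y \<in> {x..x + 1}" for y
  proof (cases "y = x")
    case False
    then have "x < y" using y by simp
    then obtain t where "cmod (u1 y - u1 x) \<le> cmod ((y - x) *\<^sub>R u2 t)"
      using mvt_general[of x y u1 "\<lambda>t h. h *\<^sub>R u2 t"] u2
      by (metis UNIV_I continuous_at_imp_continuous_on has_vector_derivative_continuous has_vector_derivative_def)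
    also have "\<dots> \<le> 1 * B2"
      unfolding norm_scaleR using y B2 by (intro mult_mono) auto
    finally show ?thesis by simp
  qed (use B2_0 in simp)
  have "cmod (u (x + 1) - u x - ((x + 1) - x) *\<^sub>R u1 x) \<le> norm ((x + 1) - x) * B2"
  proof (rule vector_differentiable_bound_linearization[where S = "{x..x + 1}"])
    show "(u has_vector_derivative u1 t) (at t within {x..x + 1})" for t
      using u1 by (rule has_vector_derivative_at_within)
    show "closed_segment x (x + 1) \<subseteq> {x..x + 1}" by (simp add: closed_segment_eq_real_ivl)
  qed (use lip in auto)
  then have "cmod (u (x + 1) - u x - u1 x) \<le> B2" by simp
  moreover have "cmod (u1 x) \<le> cmod (u (x + 1) - u x - u1 x) + (cmod (u (x + 1)) + cmod (u x))"
    using norm_triangle_ineq4[of "u (x + 1) - u x" "u (x + 1) - u x - u1 x"] norm_triangle_ineq4[of "u (x + 1)" "u x"]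
    by simp
  ultimately show ?thesis using B[of x] B[of "x + 1"] by linarith
qed

text \<open>Dividing by \<open>sqrt (r^2 + a^2)\<close> removes the second summand of
  \<open>Vpot\<close>: it cancels against the derivative \<open>k'\<close> of
  \<open>\<Delta> r / \<rho>^3\<close>. \<open>P\<close> is \<open>\<Delta>\<close> times the
  derivative of \<open>R\<close>, and the terms in \<open>u1\<close> cancel because
  \<open>\<rho>^2 = r^2 + a^2\<close> is also the numerator of \<open>d rs / dr\<close>.\<close>

lemma radial_system:
  fixes M a :: real and \<omega> lam :: complex and m :: int and rs :: "real \<Rightarrow> real" and u u1 u2 :: "real \<Rightarrow> complex"
  assumes r: "0 < r" and \<Delta>: "Delta M a r \<noteq> 0"
    and rs: "(rs has_real_derivative (r\<^sup>2 + a\<^sup>2) / Delta M a r) (at r)"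
    and u1: "(u has_vector_derivative u1 (rs r)) (at (rs r))"
    and u2: "(u1 has_vector_derivative u2 (rs r)) (at (rs r))"
    and ode: "u2 (rs r) + (\<omega>\<^sup>2 - Vpot M a \<omega> m lam r) * u (rs r) = 0"
  defines "R \<equiv> \<lambda>r. u (rs r) / of_real (sqrt (r\<^sup>2 + a\<^sup>2))"
    and "P \<equiv> \<lambda>r. of_real (sqrt (r\<^sup>2 + a\<^sup>2)) * u1 (rs r) - of_real (Delta M a r * r / sqrt (r\<^sup>2 + a\<^sup>2) ^ 3) * u (rs r)"
  shows "(R has_vector_derivative P r / of_real (Delta M a r)) (at r)"
    and "(P has_vector_derivative
      - ((of_real ((r\<^sup>2 + a\<^sup>2)\<^sup>2) * \<omega>\<^sup>2 - of_real (4 * M * r * a * of_int m) * \<omega> + of_real (a\<^sup>2 * (of_int m)\<^sup>2)) / of_real (Delta M a r)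
          - lam - of_real (a\<^sup>2) * \<omega>\<^sup>2) * R r) (at r)"
proof -
  define \<rho> where "\<rho> r = sqrt (r\<^sup>2 + a\<^sup>2)" for r
  have q0: "0 < r\<^sup>2 + a\<^sup>2" using r by (simp add: add_pos_nonneg)
  have \<rho>0: "0 < \<rho> r" and \<rho>2: "(\<rho> r)\<^sup>2 = r\<^sup>2 + a\<^sup>2" using q0 by (simp_all add: \<rho>_def)
  have d\<rho>: "(\<rho> has_real_derivative r / \<rho> r) (at r)"
    unfolding \<rho>_def [abs_def] using q0
    by (auto intro!: derivative_eq_intros simp: field_simps)
  have dj: "((\<lambda>r. 1 / \<rho> r) has_real_derivative - r / \<rho> r ^ 3) (at r)"
    using \<rho>0 by (auto intro!: derivative_eq_intros d\<rho> simp: field_simps power3_eq_cube)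
  define k' where "k' = ((2 * r - 2 * M) * r + Delta M a r) / \<rho> r ^ 3 - 3 * Delta M a r * r\<^sup>2 / \<rho> r ^ 5"
  have d\<Delta>: "(Delta M a has_real_derivative 2 * r - 2 * M) (at r)"
    unfolding Delta_def [abs_def] by (auto intro!: derivative_eq_intros)
  have "((\<lambda>r. Delta M a r * r) has_real_derivative (2 * r - 2 * M) * r + Delta M a r) (at r)"
    by (auto intro!: derivative_eq_intros d\<Delta>)
  moreover have "((\<lambda>r. \<rho> r ^ 3) has_real_derivative 3 * \<rho> r * r) (at r)"
    using \<rho>0 by (auto intro!: derivative_eq_intros d\<rho> simp: power2_eq_square)
  ultimately have "((\<lambda>r. Delta M a r * r / \<rho> r ^ 3) has_real_derivative
      (((2 * r - 2 * M) * r + Delta M a r) * \<rho> r ^ 3 - (Delta M a r * r) * (3 * \<rho> r * r)) / (\<rho> r ^ 3 * \<rho> r ^ 3)) (at r)"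
    using \<rho>0 by (intro DERIV_divide) auto
  also have "(((2 * r - 2 * M) * r + Delta M a r) * \<rho> r ^ 3 - (Delta M a r * r) * (3 * \<rho> r * r)) / (\<rho> r ^ 3 * \<rho> r ^ 3) = k'"
    unfolding k'_def diff_divide_distrib using \<rho>0 by (simp add: field_simps power2_eq_square eval_nat_numeral)
  finally have dk: "((\<lambda>r. Delta M a r * r / \<rho> r ^ 3) has_real_derivative k') (at r)" .
  have rs': "(rs has_vector_derivative (r\<^sup>2 + a\<^sup>2) / Delta M a r) (at r)"
    using rs by (simp add: has_real_derivative_iff_has_vector_derivative)
  have dv: "((\<lambda>r. u (rs r)) has_vector_derivative of_real ((r\<^sup>2 + a\<^sup>2) / Delta M a r) * u1 (rs r)) (at r)"
    using vector_diff_chain_at[OF rs' u1] by (simp add: o_def scaleR_conv_of_real)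
  have dw: "((\<lambda>r. u1 (rs r)) has_vector_derivative of_real ((r\<^sup>2 + a\<^sup>2) / Delta M a r) * u2 (rs r)) (at r)"
    using vector_diff_chain_at[OF rs' u2] by (simp add: o_def scaleR_conv_of_real)
  define x p d mm \<alpha> where "x = complex_of_real r" and "p = complex_of_real (\<rho> r)"
    and "d = complex_of_real (Delta M a r)" and "mm = complex_of_real M" and "\<alpha> = complex_of_real a"
  define q where "q = complex_of_real (r\<^sup>2 + a\<^sup>2)"
  have nz: "p \<noteq> 0" "d \<noteq> 0" "q \<noteq> 0" using \<rho>0 \<Delta> q0 unfolding p_def d_def q_def by (auto simp only: of_real_eq_0_iff)
  have q: "q = p\<^sup>2" "q = x\<^sup>2 + \<alpha>\<^sup>2"
    by (simp_all add: q_def p_def x_def \<alpha>_def \<rho>2 flip: of_real_power)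
  have d: "d = x\<^sup>2 - 2 * mm * x + \<alpha>\<^sup>2" by (simp add: d_def Delta_def x_def mm_def \<alpha>_def)
  have R_eq: "R = (\<lambda>r. of_real (1 / \<rho> r) * u (rs r))"
    by (simp add: R_def \<rho>_def fun_eq_iff)
  have P_eq: "P = (\<lambda>r. of_real (\<rho> r) * u1 (rs r) - of_real (Delta M a r * r / \<rho> r ^ 3) * u (rs r))"
    by (simp add: P_def \<rho>_def fun_eq_iff)
  show "(R has_vector_derivative P r / of_real (Delta M a r)) (at r)"
    unfolding R_eq using has_vector_derivative_mult[OF has_vector_derivative_of_real[OF dj] dv]
  proof (rule has_vector_derivative_eq_rhs)
    have "(1 / p) * (q / d * u1 (rs r)) + - x / p ^ 3 * u (rs r) = (p * u1 (rs r) - d * x / p ^ 3 * u (rs r)) / d"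
      unfolding q(1) using nz(1,2) by (simp add: field_simps power2_eq_square)
    then show "complex_of_real (1 / \<rho> r) * (complex_of_real ((r\<^sup>2 + a\<^sup>2) / Delta M a r) * u1 (rs r))
        + complex_of_real (- r / \<rho> r ^ 3) * u (rs r) = P r / of_real (Delta M a r)"
      unfolding P_eq by (simp add: q_def p_def d_def x_def)
  qed
  show "(P has_vector_derivative
      - ((of_real ((r\<^sup>2 + a\<^sup>2)\<^sup>2) * \<omega>\<^sup>2 - of_real (4 * M * r * a * of_int m) * \<omega> + of_real (a\<^sup>2 * (of_int m)\<^sup>2)) / of_real (Delta M a r)
          - lam - of_real (a\<^sup>2) * \<omega>\<^sup>2) * R r) (at r)"
    unfolding P_eq
    using has_vector_derivative_diff[OF has_vector_derivative_mult[OF has_vector_derivative_of_real[OF d\<rho>] dw]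
        has_vector_derivative_mult[OF has_vector_derivative_of_real[OF dk] dv]]
  proof (rule has_vector_derivative_eq_rhs)
    define X n where "X = \<alpha>\<^sup>2 * d + 2 * mm * x * (x\<^sup>2 - \<alpha>\<^sup>2)" and "n = complex_of_real (of_int m)"
    define N where "N = 4 * mm * x * \<alpha> * n * \<omega> - \<alpha>\<^sup>2 * n\<^sup>2 + d * (lam + \<alpha>\<^sup>2 * \<omega>\<^sup>2)"
    have k: "complex_of_real k' = X / (q\<^sup>2 * p)"
    proof -
      have "complex_of_real k' = ((2 * x - 2 * mm) * x + d) / p ^ 3 - 3 * d * x\<^sup>2 / p ^ 5"
        by (simp add: k'_def x_def mm_def d_def p_def)
      also have "\<dots> = (((2 * x - 2 * mm) * x + d) * q - 3 * d * x\<^sup>2) / (q\<^sup>2 * p)"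
        unfolding q(1) using nz(1) by (simp add: field_simps eval_nat_numeral)
      also have "((2 * x - 2 * mm) * x + d) * q - 3 * d * x\<^sup>2 = X"
        unfolding q(2) X_def d by (simp add: algebra_simps eval_nat_numeral)
      finally show ?thesis .
    qed
    have V: "Vpot M a \<omega> m lam r = N / q\<^sup>2 + d / q ^ 4 * X"
      by (simp add: Vpot_def N_def X_def d_def q_def x_def mm_def \<alpha>_def n_def)
    have u2_eq: "u2 (rs r) = - (\<omega>\<^sup>2 - (N / q\<^sup>2 + d / q ^ 4 * X)) * u (rs r)"
      using ode unfolding V by (simp only: mult_minus_left eq_neg_iff_add_eq_0)
    have main: "p * (q / d * u2 (rs r)) + x / p * u1 (rs r) - (d * x / p ^ 3 * (q / d * u1 (rs r)) + X / (q\<^sup>2 * p) * u (rs r))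
       = - ((q\<^sup>2 * \<omega>\<^sup>2 - 4 * mm * x * \<alpha> * n * \<omega> + \<alpha>\<^sup>2 * n\<^sup>2) / d - lam - \<alpha>\<^sup>2 * \<omega>\<^sup>2) * (u (rs r) / p)"
    proof -
      have h1: "x / p * u1 (rs r) = d * x / p ^ 3 * (q / d * u1 (rs r))"
        unfolding q(1) using nz(1,2) by (simp add: field_simps eval_nat_numeral)
      have h2: "p * (q / d * (d / q ^ 4 * X)) = X / (q\<^sup>2 * p)"
        unfolding q(1) using nz(1,2) by (simp add: field_simps eval_nat_numeral)
      have h3: "p * (q / d * (\<omega>\<^sup>2 - N / q\<^sup>2)) = ((q\<^sup>2 * \<omega>\<^sup>2 - N) / d) / p"
        unfolding q(1) using nz(1,2) by (simp add: field_simps eval_nat_numeral)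
      have h4: "(q\<^sup>2 * \<omega>\<^sup>2 - N) / d = (q\<^sup>2 * \<omega>\<^sup>2 - 4 * mm * x * \<alpha> * n * \<omega> + \<alpha>\<^sup>2 * n\<^sup>2) / d - lam - \<alpha>\<^sup>2 * \<omega>\<^sup>2"
        unfolding N_def using nz(2) by (simp add: field_simps)
      have h5: "p * (q / d * u2 (rs r)) = - (p * (q / d * (\<omega>\<^sup>2 - N / q\<^sup>2))) * u (rs r) + p * (q / d * (d / q ^ 4 * X)) * u (rs r)"
        unfolding u2_eq by (simp add: ring_distribs mult_ac)
      show ?thesis
        unfolding h4 [symmetric] h5 h1 [symmetric] h2 h3 by simp
    qed
    show "complex_of_real (\<rho> r) * (complex_of_real ((r\<^sup>2 + a\<^sup>2) / Delta M a r) * u2 (rs r)) + complex_of_real (r / \<rho> r) * u1 (rs r)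
       - (complex_of_real (Delta M a r * r / \<rho> r ^ 3) * (complex_of_real ((r\<^sup>2 + a\<^sup>2) / Delta M a r) * u1 (rs r)) + complex_of_real k' * u (rs r))
       = - ((of_real ((r\<^sup>2 + a\<^sup>2)\<^sup>2) * \<omega>\<^sup>2 - of_real (4 * M * r * a * of_int m) * \<omega> + of_real (a\<^sup>2 * (of_int m)\<^sup>2)) / of_real (Delta M a r)
          - lam - of_real (a\<^sup>2) * \<omega>\<^sup>2) * R r"
      using main unfolding k R_eq
      by (simp add: q_def p_def d_def x_def mm_def \<alpha>_def n_def)
  qed
qed

text \<open>Here \<open>c = 2 M\<close>, \<open>A2 = a^2 = r_+ r_-\<close>, \<open>g = a m\<close>
  and \<open>rm = r_-\<close>. As \<open>r^2 + a^2 = \<Delta> + 2 M r\<close>, division by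
  \<open>\<Delta> = s * y\<close> leaves a remainder linear in \<open>r\<close>; its residues at the
  two horizons are, up to sign, squares and produce \<open>\<xi>^2\<close> and
  \<open>\<eta>^2\<close>.\<close>

lemma partial_fraction_algebra:
  fixes s y rm D \<omega> g c A2 :: complex
  assumes y: "y = s - D" and nz: "s \<noteq> 0" "y \<noteq> 0" "D \<noteq> 0"
    and c: "c = 2 * rm + D" and A2: "A2 = (rm + D) * rm"
  shows "(((s + rm)\<^sup>2 + A2)\<^sup>2 * \<omega>\<^sup>2 - 2 * c * (s + rm) * g * \<omega> + g\<^sup>2) / (s * y)
    = \<omega>\<^sup>2 * (s * y) + 2 * c * \<omega>\<^sup>2 * (s + rm) + c\<^sup>2 * \<omega>\<^sup>2
      + (g - c * (rm + D) * \<omega>)\<^sup>2 / (D * y) - (g - c * rm * \<omega>)\<^sup>2 / (D * s)"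
proof -
  define r where "r = s + rm"
  have r2: "r\<^sup>2 + A2 = s * y + c * r"
    unfolding r_def A2 c y by (simp add: algebra_simps power2_eq_square)
  have "(g - c * (rm + D) * \<omega>)\<^sup>2 * s - (g - c * rm * \<omega>)\<^sup>2 * y = D * (g\<^sup>2 - 2 * c * g * \<omega> * r + c\<^sup>2 * \<omega>\<^sup>2 * (c * r - A2))"
    unfolding r_def A2 c y by (simp add: algebra_simps power2_eq_square)
  then have "(g - c * (rm + D) * \<omega>)\<^sup>2 / (D * y) - (g - c * rm * \<omega>)\<^sup>2 / (D * s) = (g\<^sup>2 - 2 * c * g * \<omega> * r + c\<^sup>2 * \<omega>\<^sup>2 * (c * r - A2)) / (s * y)"
    using nz by (simp add: divide_simps)
  moreover have "(r\<^sup>2 + A2)\<^sup>2 * \<omega>\<^sup>2 = (\<omega>\<^sup>2 * (s * y) + 2 * c * \<omega>\<^sup>2 * r + c\<^sup>2 * \<omega>\<^sup>2) * (s * y) + c\<^sup>2 * \<omega>\<^sup>2 * (c * r - A2)"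
  proof -
    have e: "c * r - A2 = r\<^sup>2 - s * y" using r2 by (simp add: algebra_simps)
    show ?thesis unfolding r2 e by (simp add: algebra_simps power2_eq_square)
  qed
  then have "((r\<^sup>2 + A2)\<^sup>2 * \<omega>\<^sup>2 - 2 * c * r * g * \<omega> + g\<^sup>2) / (s * y)
    = (\<omega>\<^sup>2 * (s * y) + 2 * c * \<omega>\<^sup>2 * r + c\<^sup>2 * \<omega>\<^sup>2) + (g\<^sup>2 - 2 * c * g * \<omega> * r + c\<^sup>2 * \<omega>\<^sup>2 * (c * r - A2)) / (s * y)"
    using nz by (simp add: field_simps)
  ultimately show ?thesis unfolding r_def [symmetric] by (simp add: algebra_simps)
qed

text \<open>With \<open>q = r^2 + a^2\<close>, everything follows from
  \<open>0 \<le> \<Delta> \<le> q\<close>, \<open>2 M r \<le> q\<close> and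
  \<open>M^2 \<le> q\<close> outside the horizon.\<close>

lemma Vpot_bounded:
  assumes M: "0 < M" and a: "\<bar>a\<bar> < M"
  obtains K where "\<And>r. r_plus M a < r \<Longrightarrow> cmod (\<omega>\<^sup>2 - Vpot M a \<omega> m lam r) \<le> K"
proof -
  define L where "L = 4 * \<bar>a * of_int m\<bar> * cmod \<omega> + a\<^sup>2 * (of_int m)\<^sup>2 / M\<^sup>2 + cmod (lam + complex_of_real (a\<^sup>2) * \<omega>\<^sup>2)"
  have "cmod (\<omega>\<^sup>2 - Vpot M a \<omega> m lam r) \<le> (cmod \<omega>)\<^sup>2 + (L / M\<^sup>2 + 2 / M\<^sup>2)" if r: "r_plus M a < r" for r
  proof -
    define q where "q = r\<^sup>2 + a\<^sup>2"
    define d where "d = Delta M a r"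
    have a2: "a\<^sup>2 \<le> M\<^sup>2" using a M abs_le_square_iff[of a M] by simp
    then have "0 \<le> sqrt (M\<^sup>2 - a\<^sup>2)" by simp
    then have rM: "M < r" using r unfolding r_plus_def by linarith
    have d_eq: "d = q - 2 * M * r" by (simp add: d_def q_def Delta_def)
    have d0: "0 \<le> d"
    proof -
      have "sqrt (M\<^sup>2 - a\<^sup>2) \<le> r - M" using r by (simp add: r_plus_def)
      then have "(sqrt (M\<^sup>2 - a\<^sup>2))\<^sup>2 \<le> (r - M)\<^sup>2"
        using a2 by (intro power_mono) auto
      then show ?thesis
        using a2 by (simp add: d_def Delta_def power2_diff algebra_simps)
    qed
    have qM: "M\<^sup>2 \<le> q"
      using rM M power_mono[of M r 2] by (simp add: q_def add_increasing2)
    have q0: "0 < q" using qM M by (smt (verit) zero_less_power)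
    have Mr: "2 * M * r \<le> q" using d0 d_eq by simp
    have dq: "d \<le> q" using d_eq M rM by simp
    have "cmod (complex_of_real (4*M*r*a* of_int m) * \<omega> - complex_of_real (a^2 * (of_int m)^2)
        + complex_of_real d * (lam + complex_of_real (a^2) * \<omega>^2))
      \<le> cmod (complex_of_real (4*M*r*a* of_int m) * \<omega>) + cmod (complex_of_real (a^2 * (of_int m)^2))
        + cmod (complex_of_real d * (lam + complex_of_real (a^2) * \<omega>^2))"
      by (meson norm_triangle_ineq norm_triangle_ineq4 order_trans add_right_mono)
    also have "\<dots> = 2 * (2 * M * r) * \<bar>a * of_int m\<bar> * cmod \<omega> + a\<^sup>2 * (of_int m)\<^sup>2
        + d * cmod (lam + complex_of_real (a^2) * \<omega>^2)"
      unfolding norm_mult norm_of_real using M rM d0 by (simp add: abs_mult)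
    also have "\<dots> \<le> 4 * q * \<bar>a * of_int m\<bar> * cmod \<omega> + a\<^sup>2 * (of_int m)\<^sup>2 / M\<^sup>2 * q
        + q * cmod (lam + complex_of_real (a^2) * \<omega>^2)"
    proof (intro add_mono mult_right_mono)
      show "2 * (2 * M * r) \<le> 4 * q" using Mr q0 by linarith
      have "a\<^sup>2 * (of_int m)\<^sup>2 / M\<^sup>2 * M\<^sup>2 \<le> a\<^sup>2 * (of_int m)\<^sup>2 / M\<^sup>2 * q"
        using qM by (intro mult_left_mono) auto
      then show "a\<^sup>2 * (of_int m)\<^sup>2 \<le> a\<^sup>2 * (of_int m)\<^sup>2 / M\<^sup>2 * q" using M by simp
    qed (use dq in auto)
    also have "\<dots> = L * q" by (simp add: L_def algebra_simps)
    finally have n1: "cmod (complex_of_real (4*M*r*a* of_int m) * \<omega> - complex_of_real (a^2 * (of_int m)^2)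
        + complex_of_real d * (lam + complex_of_real (a^2) * \<omega>^2)) \<le> L * q" .
    have L0: "0 \<le> L" by (simp add: L_def)
    have t1: "cmod ((complex_of_real (4*M*r*a* of_int m) * \<omega> - complex_of_real (a^2 * (of_int m)^2)
        + complex_of_real d * (lam + complex_of_real (a^2) * \<omega>^2)) / complex_of_real (q^2)) \<le> L / M\<^sup>2"
    proof -
      have "cmod ((complex_of_real (4*M*r*a* of_int m) * \<omega> - complex_of_real (a^2 * (of_int m)^2)
        + complex_of_real d * (lam + complex_of_real (a^2) * \<omega>^2)) / complex_of_real (q^2)) \<le> L * q / q\<^sup>2"
        unfolding norm_divide norm_of_real using n1 by (simp add: divide_right_mono)
      also have "\<dots> = L / q" using q0 by (simp add: power2_eq_square)
      also have "\<dots> \<le> L / M\<^sup>2" using qM M L0 q0 by (intro divide_left_mono) auto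
      finally show ?thesis .
    qed
    have t2: "\<bar>d / q ^ 4 * (a\<^sup>2 * d + 2 * M * r * (r\<^sup>2 - a\<^sup>2))\<bar> \<le> 2 / M\<^sup>2"
    proof -
      have "\<bar>a\<^sup>2 * d + 2 * M * r * (r\<^sup>2 - a\<^sup>2)\<bar> \<le> \<bar>a\<^sup>2 * d\<bar> + \<bar>2 * M * r * (r\<^sup>2 - a\<^sup>2)\<bar>" by simp
      also have "\<dots> = a\<^sup>2 * d + 2 * M * r * \<bar>r\<^sup>2 - a\<^sup>2\<bar>"
        using d0 M rM by (simp add: abs_mult)
      also have "\<dots> \<le> q * q + q * q"
      proof -
        have "a\<^sup>2 \<le> q" "\<bar>r\<^sup>2 - a\<^sup>2\<bar> \<le> q" by (auto simp: q_def abs_le_iff)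
        then show ?thesis using d0 dq Mr q0 M rM by (intro add_mono mult_mono) auto
      qed
      finally have "\<bar>a\<^sup>2 * d + 2 * M * r * (r\<^sup>2 - a\<^sup>2)\<bar> \<le> 2 * q\<^sup>2" by (simp add: power2_eq_square)
      then have "d / q ^ 4 * \<bar>a\<^sup>2 * d + 2 * M * r * (r\<^sup>2 - a\<^sup>2)\<bar> \<le> q / q ^ 4 * (2 * q\<^sup>2)"
        using d0 dq q0 by (intro mult_mono divide_right_mono) auto
      also have "\<dots> = 2 / q" using q0 by (simp add: field_simps power2_eq_square power4_eq_xxxx)
      also have "\<dots> \<le> 2 / M\<^sup>2" using qM M q0 by (intro divide_left_mono) auto
      finally show ?thesis using d0 q0 by (simp add: abs_mult)
    qed
    have "cmod (Vpot M a \<omega> m lam r) \<le> L / M\<^sup>2 + 2 / M\<^sup>2"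
      unfolding Vpot_def q_def [symmetric] d_def [symmetric]
      by (rule order_trans[OF norm_triangle_ineq add_mono[OF t1]]) (use t2 in \<open>simp only: norm_of_real\<close>)
    then show ?thesis
      using norm_triangle_ineq4[of "\<omega>\<^sup>2" "Vpot M a \<omega> m lam r"] by (simp add: norm_power)
  qed
  then show ?thesis by (rule that)
qed

text \<open>The term with \<open>a m\<close> is purely imaginary, so the sign of the real part comes
  from \<open>Im \<omega>\<close> alone.\<close>

lemma Re_xi:
  assumes "0 < M" "\<bar>a\<bar> < M" "0 < Im \<omega>"
  shows "0 < Re (xi M a \<omega> m)"
proof -
  have "a\<^sup>2 < M\<^sup>2" using assms(1,2) power_strict_mono[of "\<bar>a\<bar>" M 2] by simp
  then have D: "0 < r_plus M a - r_minus M a" and rp: "0 < r_plus M a"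
    using assms(1) by (auto simp: r_plus_def r_minus_def add_pos_pos)
  have "Re (xi M a \<omega> m) = 2 * M * r_plus M a * Im \<omega> / (r_plus M a - r_minus M a)"
    unfolding xi_def Re_divide_of_real by simp
  then show ?thesis using D rp assms by simp
qed

text \<open>Near the horizon \<open>u\<close> is a bounded function times a power with
  \<open>Re \<xi> > 0\<close> and base at most one. Far out, \<open>exp (i \<omega> rs)\<close> is
  bounded because \<open>Im \<omega> > 0\<close> and \<open>rs\<close> increases. A compact interval
  lies in between.\<close>

lemma mode_bounded:
  assumes M: "0 < M" and a: "\<bar>a\<bar> < M" and rs: "tortoise M a rs" and \<omega>: "0 < Im \<omega>"
    and u: "continuous_on UNIV u" and bc: "mode_bc M a rs \<omega> m u"
  obtains B where "\<And>x. cmod (u x) \<le> B"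
proof -
  define rp where "rp = r_plus M a"
  from rs have mono: "strict_mono_on {rp<..} rs" and surj: "rs ` {rp<..} = UNIV"
    and der: "\<And>r. r \<in> {rp<..} \<Longrightarrow> (rs has_real_derivative (r\<^sup>2 + a\<^sup>2) / Delta M a r) (at r)"
    unfolding tortoise_def rp_def by blast+
  have rs_cont: "continuous_on {rp<..} rs"
    using der DERIV_isCont by (intro continuous_at_imp_continuous_on ballI) blast
  from bc have "\<exists>g :: real \<Rightarrow> complex. smooth_on UNIV g \<and> (\<forall>r\<in>{rp<..}. g r = rcpow (r - rp) (- xi M a \<omega> m) * u (rs r))"
    unfolding mode_bc_def rp_def by (rule conjunct1)
  then obtain g where g: "smooth_on UNIV g"
    and gu: "\<And>r. r \<in> {rp<..} \<Longrightarrow> g r = rcpow (r - rp) (- xi M a \<omega> m) * u (rs r)"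
    by blast
  from bc have "\<exists>C. \<forall>N::nat. N \<ge> 1 \<longrightarrow> (\<exists>K R. \<forall>r. r > R \<longrightarrow>
           cmod (u (rs r) - exp (\<i> * \<omega> * complex_of_real (rs r)) * (\<Sum>i\<le>N. C i / complex_of_real (r ^ i)))
             \<le> K / r ^ (N + 1))"
    unfolding mode_bc_def by (rule conjunct2)
  then obtain C where "\<forall>N::nat. N \<ge> 1 \<longrightarrow> (\<exists>K R. \<forall>r. r > R \<longrightarrow>
           cmod (u (rs r) - exp (\<i> * \<omega> * complex_of_real (rs r)) * (\<Sum>i\<le>N. C i / complex_of_real (r ^ i)))
             \<le> K / r ^ (N + 1))"
    by blast
  then obtain K R0 where KR: "\<And>r. r > R0 \<Longrightarrow>
       cmod (u (rs r) - exp (\<i> * \<omega> * complex_of_real (rs r)) * (\<Sum>i\<le>1. C i / complex_of_real (r ^ i))) \<le> K / r ^ (1 + 1)"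
    by (metis le_refl)
  \<comment> \<open>Past \<open>R1\<close> the expansion with \<open>N = 1\<close> is valid, and
    \<open>1 \<le> r\<close> bounds its negative powers by constants.\<close>
  define R1 where "R1 = Max {R0 + 1, rp + 1, 1}"
  have R1: "R0 < R1" "rp < R1" "1 \<le> R1" by (auto simp: R1_def)
  have far: "cmod (u (rs r)) \<le> exp (- Im \<omega> * rs R1) * (cmod (C 0) + cmod (C 1)) + \<bar>K\<bar>" if r: "R1 \<le> r" for r
  proof -
    have r1: "1 \<le> r" "R0 < r" using r R1 by auto
    have "rs R1 \<le> rs r"
      using strict_mono_onD[OF mono, of R1 r] R1 r by (cases "R1 = r") auto
    then have e: "cmod (exp (\<i> * \<omega> * complex_of_real (rs r))) \<le> exp (- Im \<omega> * rs R1)"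
      using \<omega> by simp
    have "cmod (\<Sum>i\<le>1. C i / complex_of_real (r ^ i)) \<le> cmod (C 0) + cmod (C 1 / complex_of_real r)"
      by (simp add: norm_triangle_ineq)
    also have "cmod (C 1 / complex_of_real r) \<le> cmod (C 1) / 1"
      unfolding norm_divide norm_of_real using r1 by (intro divide_left_mono) auto
    finally have s: "cmod (\<Sum>i\<le>1. C i / complex_of_real (r ^ i)) \<le> cmod (C 0) + cmod (C 1)" by simp
    have "1 \<le> r ^ (1 + 1)" using r1(1) by (rule one_le_power)
    then have "K / r ^ (1 + 1) \<le> \<bar>K\<bar> / 1" by (intro frac_le) auto
    then have k: "cmod (u (rs r) - exp (\<i> * \<omega> * complex_of_real (rs r)) * (\<Sum>i\<le>1. C i / complex_of_real (r ^ i))) \<le> \<bar>K\<bar>"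
      using KR[OF r1(2)] by linarith
    have "cmod (exp (\<i> * \<omega> * complex_of_real (rs r)) * (\<Sum>i\<le>1. C i / complex_of_real (r ^ i)))
        \<le> exp (- Im \<omega> * rs R1) * (cmod (C 0) + cmod (C 1))"
      unfolding norm_mult by (intro mult_mono e s) auto
    then show ?thesis
      using k norm_triangle_sub[of "u (rs r)" "exp (\<i> * \<omega> * complex_of_real (rs r)) * (\<Sum>i\<le>1. C i / complex_of_real (r ^ i))"]
      by linarith
  qed
  have "continuous_on UNIV g" using g unfolding smooth_on_def by (metis Ck_on.simps(1))
  then have "bounded (g ` {rp..rp + 1})"
    by (intro compact_imp_bounded compact_continuous_image) (auto intro: continuous_on_subset)
  then obtain B1 where B1: "\<And>r. r \<in> {rp..rp + 1} \<Longrightarrow> cmod (g r) \<le> B1"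
    unfolding bounded_iff by (metis imageI)
  have near: "cmod (u (rs r)) \<le> B1" if r: "rp < r" "r \<le> rp + 1" for r
  proof -
    have "u (rs r) = rcpow (r - rp) (xi M a \<omega> m) * g r"
      using gu[of r] r by (simp add: rcpow_minus_mult)
    moreover have "cmod (rcpow (r - rp) (xi M a \<omega> m)) \<le> 1"
      using Re_xi[OF M a \<omega>, of m] r by (simp add: norm_rcpow mult_nonneg_nonpos)
    ultimately have "cmod (u (rs r)) \<le> 1 * B1"
      unfolding norm_mult using B1[of r] r by (simp only: norm_mult) (intro mult_mono, auto)
    then show ?thesis by simp
  qed
  have "continuous_on {rp + 1..R1} (\<lambda>r. u (rs r))"
    by (rule continuous_on_compose2[OF u]) (auto intro: continuous_on_subset[OF rs_cont])
  then have "bounded ((\<lambda>r. u (rs r)) ` {rp + 1..R1})"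
    by (intro compact_imp_bounded compact_continuous_image) auto
  then obtain B2 where B2: "\<And>r. r \<in> {rp + 1..R1} \<Longrightarrow> cmod (u (rs r)) \<le> B2"
    unfolding bounded_iff by blast
  define B3 where "B3 = exp (- Im \<omega> * rs R1) * (cmod (C 0) + cmod (C 1)) + \<bar>K\<bar>"
  have "cmod (u x) \<le> Max {B1, B2, B3}" for x
  proof -
    obtain r where r: "rp < r" "x = rs r" using surj by (metis UNIV_I greaterThan_iff imageE)
    consider "r \<le> rp + 1" | "r \<in> {rp + 1..R1}" | "R1 \<le> r" by fastforce
    then show ?thesis
    proof cases
      case 1
      then show ?thesis using near[OF r(1)] r(2) by (simp add: le_max_iff_disj)
    next
      case 2
      then show ?thesis using B2 r(2) by (simp add: le_max_iff_disj)
    next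
      case 3
      then show ?thesis using far r(2) by (simp add: le_max_iff_disj B3_def)
    qed
  qed
  then show ?thesis by (rule that)
qed

section \<open>Absence of modes in the upper half-plane\<close>

theorem mainTheorem2:
  fixes M a :: real and \<omega> lam :: complex and m :: int
    and rs :: "real \<Rightarrow> real" and u :: "real \<Rightarrow> complex"
  assumes "M > 0" and "\<bar>a\<bar> < M"
    and "tortoise M a rs"
    and "Im \<omega> > 0"
    and "angular_eigenvalue a \<omega> m lam"
    and "radial_hom_solution M a rs \<omega> m lam u"
    and "mode_bc M a rs \<omega> m u"
  shows "\<forall>x. u x = 0"
proof -
  note M = assms(1) and a = assms(2) and \<omega> = assms(4)
  define rp rm D where "rp = r_plus M a" and "rm = r_minus M a" and "D = rp - rm"
  have "a\<^sup>2 < M\<^sup>2" using M a power_strict_mono[of "\<bar>a\<bar>" M 2] by simp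
  then have sq: "0 < sqrt (M\<^sup>2 - a\<^sup>2)" "(sqrt (M\<^sup>2 - a\<^sup>2))\<^sup>2 = M\<^sup>2 - a\<^sup>2" by simp_all
  have D0: "0 < D" and sum: "rp + rm = 2 * M" and Mrp: "M < rp" and rmM: "rm < M"
    using sq(1) by (simp_all add: D_def rp_def rm_def r_plus_def r_minus_def)
  have prod: "rp * rm = a\<^sup>2"
    using sq(2) by (simp add: rp_def rm_def r_plus_def r_minus_def algebra_simps power2_eq_square)
  have csum: "2 * complex_of_real M = complex_of_real rm + complex_of_real rp"
    using arg_cong[OF sum, of complex_of_real] by (simp add: add.commute)
  have \<Delta>: "Delta M a (s + rm) = s * (s - D)" for s
    unfolding Delta_def prod [symmetric] D_def sum [symmetric] by (simp add: algebra_simps power2_eq_square)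
  from assms(6) obtain u1 u2 where "\<forall>x. (u has_vector_derivative u1 x) (at x) \<and> (u1 has_vector_derivative u2 x) (at x)"
    and "\<forall>r\<in>{r_plus M a<..}. u2 (rs r) + (\<omega>\<^sup>2 - Vpot M a \<omega> m lam r) * u (rs r) = 0"
    unfolding radial_hom_solution_def by blast
  then have u1: "\<And>x. (u has_vector_derivative u1 x) (at x)" and u2: "\<And>x. (u1 has_vector_derivative u2 x) (at x)"
    and ode: "\<And>r. rp < r \<Longrightarrow> u2 (rs r) + (\<omega>\<^sup>2 - Vpot M a \<omega> m lam r) * u (rs r) = 0"
    by (auto simp: rp_def)
  from assms(3) have surj: "rs ` {rp<..} = UNIV"
    and rs: "\<forall>r\<in>{rp<..}. (rs has_real_derivative (r\<^sup>2 + a\<^sup>2) / Delta M a r) (at r)"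
    unfolding tortoise_def rp_def by blast+
  have ex_r: "\<exists>r>rp. x = rs r" for x using surj by (metis UNIV_I greaterThan_iff imageE)
  have "continuous_on UNIV u"
    using u1 has_vector_derivative_continuous by (intro continuous_at_imp_continuous_on) blast
  then obtain B where B: "\<And>x. cmod (u x) \<le> B"
    using mode_bounded[OF M a assms(3) \<omega> _ assms(7)] by blast
  obtain K where K: "\<And>r. rp < r \<Longrightarrow> cmod (\<omega>\<^sup>2 - Vpot M a \<omega> m lam r) \<le> K"
    using Vpot_bounded[OF M a] unfolding rp_def by blast
  have B0: "0 \<le> B" using order_trans[OF norm_ge_zero B] .
  \<comment> \<open>The equation with bounded potential bounds \<open>u''\<close>, and interpolation
    with \<open>u\<close> then bounds \<open>u'\<close>, which is needed for the growth of
    \<open>P\<close>.\<close>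
  have "cmod (u2 x) \<le> K * B" for x
  proof -
    obtain r where r: "rp < r" "x = rs r" using ex_r by blast
    have "u2 x = - ((\<omega>\<^sup>2 - Vpot M a \<omega> m lam r) * u x)"
      using ode[OF r(1)] r(2) by (simp only: eq_neg_iff_add_eq_0)
    then show ?thesis
      using K[OF r(1)] B[of x] order_trans[OF norm_ge_zero K[OF r(1)]] by (simp add: norm_mult mult_mono)
  qed
  from derivative_bounded_if_second_derivative_bounded[OF u1 u2 B this]
  obtain B1 where B1: "\<And>x. cmod (u1 x) \<le> B1" by blast
  have B10: "0 \<le> B1" using order_trans[OF norm_ge_zero B1] .
  define \<rho> where "\<rho> r = sqrt (r\<^sup>2 + a\<^sup>2)" for r
  define Rr where "Rr r = u (rs r) / of_real (\<rho> r)" for r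
  define Pr where "Pr r = of_real (\<rho> r) * u1 (rs r) - of_real (Delta M a r * r / \<rho> r ^ 3) * u (rs r)" for r
  \<comment> \<open>The indicial root \<open>\<eta>\<close> is taken with the sign opposite to
    \<open>\<xi>\<close>, so that \<open>a m\<close> cancels in \<open>\<eta> + \<xi>\<close>.
    \<open>\<kappa>\<close> gathers the terms constant in \<open>s\<close>: those of the partial
    fraction expansion, rewritten by \<open>\<omega>^2 = - \<nu>^2\<close>, and
    \<open>- lam - a^2 \<omega>^2\<close>.\<close>
  define \<nu> \<eta> \<xi> \<kappa> where "\<nu> = - \<i> * \<omega>"
    and "\<eta> = - \<i> * (of_real (a * of_int m) - of_real (2 * M * rm) * \<omega>) / of_real D"
    and "\<xi> = xi M a \<omega> m"
    and "\<kappa> = - 4 * of_real M * \<nu>\<^sup>2 * of_real rm - 4 * (of_real M)\<^sup>2 * \<nu>\<^sup>2 - lam + of_real (a\<^sup>2) * \<nu>\<^sup>2"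
  have \<omega>2: "\<omega>\<^sup>2 = - \<nu>\<^sup>2" and \<omega>_eq: "\<omega> = \<i> * \<nu>" by (simp_all add: \<nu>_def power_mult_distrib)
  have \<xi>: "\<xi> = \<i> * (of_real (a * of_int m) - of_real (2 * M * rp) * \<omega>) / of_real D"
    by (simp add: \<xi>_def xi_def rp_def rm_def D_def)
  \<comment> \<open>One constant serves both bounds: \<open>|R| \<le> B / M\<close> since
    \<open>M \<le> \<rho>\<close>, and \<open>|P| \<le> (s + 2 M) * B1 + B\<close> since
    \<open>\<rho> \<le> s + 2 M\<close>.\<close>
  interpret whiting D M "B / M + B1 * (1 + 2 * M) + B" \<nu> \<eta> \<xi> \<kappa> "\<lambda>s. Rr (s + rm)" "\<lambda>s. Pr (s + rm)"
  proof
    show "0 < D" by (rule D0)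
    show "0 < M" by (rule M)
    show "0 < Re \<nu>" using \<omega> by (simp add: \<nu>_def)
    show "0 < Re \<xi>" unfolding \<xi>_def using M a \<omega> by (rule Re_xi)
    have "\<eta> + \<xi> = \<i> * (of_real (2 * M * rm) * \<omega> - of_real (2 * M * rp) * \<omega>) / of_real D"
      unfolding \<eta>_def \<xi> by (simp add: algebra_simps flip: add_divide_distrib diff_divide_distrib)
    also have "of_real (2 * M * rm) * \<omega> - of_real (2 * M * rp) * \<omega> = - (2 * of_real M * \<omega>) * of_real D"
      by (simp add: D_def algebra_simps)
    finally show "\<eta> + \<xi> = 2 * complex_of_real M * \<nu>"
      using D0 by (simp add: \<nu>_def)
    fix s assume s: "D < s"
    have s0: "0 < s" using s D0 by simp
    define r where "r = s + rm"
    have rp: "rp < r" using s by (simp add: D_def r_def)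
    have r0: "0 < r" using rp Mrp M by simp
    have d: "Delta M a r = s * (s - D)" unfolding r_def by (rule \<Delta>)
    have d0: "0 < Delta M a r" unfolding d using s s0 by simp
    have shift: "((\<lambda>s. s + rm) has_vector_derivative 1) (at s)"
      by (auto intro!: derivative_eq_intros simp flip: has_real_derivative_iff_has_vector_derivative)
    have rs_r: "(rs has_real_derivative (r\<^sup>2 + a\<^sup>2) / Delta M a r) (at r)" using rs rp by simp
    note sys = radial_system[of r M a rs u u1 u2 \<omega> m lam, OF r0 less_imp_neq[OF d0, symmetric] rs_r u1 u2 ode[OF rp],
        folded \<rho>_def, folded Rr_def [abs_def] Pr_def [abs_def], folded Rr_def Pr_def]
    have Rr': "(Rr has_vector_derivative Pr r / of_real (s * (s - D))) (at r)"
      using sys(1) rp unfolding d by simp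
    from vector_diff_chain_at[OF shift Rr'[unfolded r_def]]
    show "((\<lambda>s. Rr (s + rm)) has_vector_derivative Pr (s + rm) / complex_of_real (s * (s - D))) (at s)"
      by (simp add: o_def)
    define x y Dc rc mc g where "x = complex_of_real s" and "y = complex_of_real (s - D)"
      and "Dc = complex_of_real D" and "rc = complex_of_real rm" and "mc = complex_of_real M"
      and "g = complex_of_real (a * of_int m)"
    have nz: "x \<noteq> 0" "y \<noteq> 0" "Dc \<noteq> 0" using s s0 D0 by (auto simp: x_def y_def Dc_def)
    have c: "2 * mc = 2 * rc + Dc"
      using csum by (simp add: mc_def rc_def Dc_def D_def)
    have A2: "complex_of_real (a\<^sup>2) = (rc + Dc) * rc" and rpc: "complex_of_real rp = rc + Dc"
      unfolding prod [symmetric] by (simp_all add: rc_def Dc_def D_def)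
    have W: "(of_real ((r\<^sup>2 + a\<^sup>2)\<^sup>2) * \<omega>\<^sup>2 - of_real (4 * M * r * a * of_int m) * \<omega> + of_real (a\<^sup>2 * (of_int m)\<^sup>2)) / of_real (Delta M a r)
          - lam - of_real (a\<^sup>2) * \<omega>\<^sup>2
       = - \<nu>\<^sup>2 * of_real (s * (s - D)) - 4 * of_real M * \<nu>\<^sup>2 * of_real s + \<kappa>
         - \<xi>\<^sup>2 * of_real D / of_real (s - D) + \<eta>\<^sup>2 * of_real D / of_real s"
    proof -
      define t1 t2 where "t1 = (g - 2 * mc * (rc + Dc) * \<omega>)\<^sup>2 / (Dc * y)" and "t2 = (g - 2 * mc * rc * \<omega>)\<^sup>2 / (Dc * x)"
      have num: "of_real ((r\<^sup>2 + a\<^sup>2)\<^sup>2) * \<omega>\<^sup>2 - of_real (4 * M * r * a * of_int m) * \<omega> + of_real (a\<^sup>2 * (of_int m)\<^sup>2)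
          = ((x + rc)\<^sup>2 + of_real (a\<^sup>2))\<^sup>2 * \<omega>\<^sup>2 - 2 * (2 * mc) * (x + rc) * g * \<omega> + g\<^sup>2"
        by (simp add: r_def x_def rc_def mc_def g_def power_mult_distrib)
      have den: "complex_of_real (Delta M a r) = x * y" "complex_of_real (s * (s - D)) = x * y"
        by (simp_all add: d x_def y_def)
      have y: "y = x - Dc" by (simp add: x_def y_def Dc_def)
      have \<xi>2: "\<xi>\<^sup>2 * Dc / y = - t1"
        unfolding t1_def \<xi> Dc_def [symmetric] of_real_mult rpc mc_def [symmetric]
        using nz by (simp add: power_divide power_mult_distrib) (simp add: power2_eq_square g_def)
      have \<eta>2: "\<eta>\<^sup>2 * Dc / x = - t2"
        unfolding t2_def \<eta>_def Dc_def [symmetric] of_real_mult rc_def [symmetric] mc_def [symmetric]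
        using nz by (simp add: power_divide power_mult_distrib) (simp add: power2_eq_square g_def)
      note pf = partial_fraction_algebra[OF y nz c A2, of \<omega> g, folded t1_def t2_def]
      show ?thesis
        unfolding num den \<kappa>_def Dc_def [symmetric] x_def [symmetric] y_def [symmetric] mc_def [symmetric] rc_def [symmetric]
        unfolding pf \<xi>2 \<eta>2 unfolding \<omega>2
        by (simp add: algebra_simps power2_eq_square)
    qed
    have Pr': "(Pr has_vector_derivative
      - (- \<nu>\<^sup>2 * of_real (s * (s - D)) - 4 * of_real M * \<nu>\<^sup>2 * of_real s + \<kappa>
         - \<xi>\<^sup>2 * of_real D / of_real (s - D) + \<eta>\<^sup>2 * of_real D / of_real s) * Rr r) (at r)"
      using sys(2) rp unfolding W by simp
    from vector_diff_chain_at[OF shift Pr'[unfolded r_def]]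
    show "((\<lambda>s. Pr (s + rm)) has_vector_derivative
      - (- \<nu>\<^sup>2 * of_real (s * (s - D)) - 4 * of_real M * \<nu>\<^sup>2 * of_real s + \<kappa>
         - \<xi>\<^sup>2 * of_real D / of_real (s - D) + \<eta>\<^sup>2 * of_real D / of_real s) * Rr (s + rm)) (at s)"
      by (simp add: o_def)
    have r\<rho>: "r \<le> \<rho> r" unfolding \<rho>_def by (rule real_le_rsqrt) simp
    have \<rho>0: "0 < \<rho> r" and M\<rho>: "M \<le> \<rho> r" using r\<rho> r0 rp Mrp by auto
    have "\<rho> r \<le> \<bar>r\<bar> + \<bar>a\<bar>" unfolding \<rho>_def by (rule sqrt_sum_squares_le_sum_abs)
    then have \<rho>s: "\<rho> r \<le> s + 2 * M" using r0 a rmM by (simp add: r_def)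
    have "cmod (Rr r) = cmod (u (rs r)) / \<rho> r" using \<rho>0 by (simp add: Rr_def norm_divide)
    also have "\<dots> \<le> B / M" using B B0 M M\<rho> by (intro frac_le) auto
    also have "\<dots> \<le> B / M + B1 * (1 + 2 * M) + B" using B0 B10 M by simp
    finally show "cmod (Rr (s + rm)) \<le> B / M + B1 * (1 + 2 * M) + B" unfolding r_def .
    have "Delta M a r \<le> (\<rho> r)\<^sup>2" using M r0 unfolding \<rho>_def Delta_def by simp
    then have "Delta M a r * r \<le> (\<rho> r)\<^sup>2 * \<rho> r" using r\<rho> r0 d0 by (intro mult_mono) auto
    then have k1: "Delta M a r * r / \<rho> r ^ 3 \<le> 1" using \<rho>0 by (simp add: power2_eq_square power3_eq_cube)
    have k0: "0 \<le> Delta M a r * r / \<rho> r ^ 3" using \<rho>0 d0 r0 by simp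
    have "cmod (Pr r) \<le> cmod (of_real (\<rho> r) * u1 (rs r)) + cmod (of_real (Delta M a r * r / \<rho> r ^ 3) * u (rs r))"
      unfolding Pr_def by (rule norm_triangle_ineq4)
    also have "\<dots> = \<rho> r * cmod (u1 (rs r)) + (Delta M a r * r / \<rho> r ^ 3) * cmod (u (rs r))"
      unfolding norm_mult norm_of_real abs_of_nonneg[OF k0] using \<rho>0 by simp
    also have "\<dots> \<le> (s + 2 * M) * B1 + 1 * B"
      using \<rho>s \<rho>0 k0 k1 B B1 s0 M by (intro add_mono mult_mono) auto
    also have "\<dots> \<le> (B / M + B1 * (1 + 2 * M) + B) * (1 + s)"
    proof -
      have "0 \<le> B / M * (1 + s)" "0 \<le> B1 * (2 * M * s)" "0 \<le> B1" "0 \<le> B * s"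
        using B0 B10 M s0 by auto
      moreover have "(B / M + B1 * (1 + 2 * M) + B) * (1 + s)
          = B / M * (1 + s) + B1 * (2 * M * s) + B1 + B * s + (s + 2 * M) * B1 + 1 * B"
        by (simp add: algebra_simps)
      ultimately show ?thesis by linarith
    qed
    finally show "cmod (Pr (s + rm)) \<le> (B / M + B1 * (1 + 2 * M) + B) * (1 + s)" unfolding r_def .
  qed
  have lam: "0 \<le> Re (cnj \<nu> * lam)"
    unfolding \<nu>_def using assms(5) \<omega> by (rule Re_cnj_eigenvalue_nonneg)
  have neg: "Re (cnj \<nu> * W' z) < 0" if z: "D < z" for z
  proof -
    \<comment> \<open>\<open>X\<close> and \<open>Y\<close> are real and the azimuthal number occurs
      in \<open>Y\<close> only. Multiplication by \<open>cnj \<nu>\<close> turns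
      \<open>\<nu>^2 X\<close> into \<open>|\<nu>|^2 X \<nu>\<close> and \<open>i \<nu> Y\<close>
      into an imaginary number, so the sign of \<open>X\<close> decides.\<close>
    define X Y where "X = - (z * (z - D)) - 4 * M\<^sup>2 * z / (z - D) - 8 * M\<^sup>2 * z / D + a\<^sup>2"
      and "Y = - 4 * a * of_int m * z / D + 2 * a * of_int m"
    have W'_eq: "W' z = \<nu>\<^sup>2 * of_real X + \<i> * \<nu> * of_real Y - lam"
    proof -
      define zc yc Dc rc mc g where "zc = complex_of_real z" and "yc = complex_of_real (z - D)"
        and "Dc = complex_of_real D" and "rc = complex_of_real rm" and "mc = complex_of_real M"
        and "g = complex_of_real (a * of_int m)"
      have nz: "Dc \<noteq> 0" using D0 by (simp add: Dc_def)
      have c: "mc = rc + Dc / 2"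
        using csum by (simp add: mc_def rc_def Dc_def D_def field_simps)
      have "- \<i> * (of_real (a * of_int m) - of_real (2 * M * rm) * \<omega>) = - \<i> * g - 2 * mc * rc * \<nu>"
        unfolding \<omega>_eq by (simp add: g_def mc_def rc_def algebra_simps)
      then have \<eta>2: "\<eta> = (- \<i> * g - 2 * mc * rc * \<nu>) / Dc"
        unfolding \<eta>_def Dc_def by (simp only:)
      then have \<eta>_eq: "\<eta> * Dc = - \<i> * g - 2 * mc * rc * \<nu>" using nz by simp
      have XY: "complex_of_real X = - (zc * yc) - 4 * mc\<^sup>2 * zc / yc - 8 * mc\<^sup>2 * zc / Dc + of_real (a\<^sup>2)"
        "complex_of_real Y = - 4 * g * zc / Dc + 2 * g"
        by (simp_all add: X_def Y_def zc_def yc_def Dc_def mc_def g_def)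
      have "W' z = - \<nu>\<^sup>2 * (zc * yc) - 4 * mc\<^sup>2 * \<nu>\<^sup>2 * zc / yc + (4 * \<nu> * \<eta> - 4 * mc * \<nu>\<^sup>2) * zc - 2 * \<nu> * (\<eta> * Dc)
          + (- 4 * mc * \<nu>\<^sup>2 * rc - 4 * mc\<^sup>2 * \<nu>\<^sup>2 - lam + of_real (a\<^sup>2) * \<nu>\<^sup>2) + 4 * mc\<^sup>2 * \<nu>\<^sup>2"
        unfolding W'_def by (simp add: \<kappa>_def zc_def yc_def Dc_def mc_def rc_def)
      also have "(4 * \<nu> * \<eta> - 4 * mc * \<nu>\<^sup>2) * zc = - 8 * mc\<^sup>2 * \<nu>\<^sup>2 * zc / Dc - 4 * \<i> * \<nu> * g * zc / Dc"
        unfolding \<eta>2 c power2_eq_square using nz by (simp add: field_simps)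
      finally show ?thesis
        unfolding XY \<eta>_eq by (simp add: algebra_simps power2_eq_square)
    qed
    have "cnj \<nu> * W' z = of_real ((cmod \<nu>)\<^sup>2 * X) * \<nu> + \<i> * of_real ((cmod \<nu>)\<^sup>2 * Y) - cnj \<nu> * lam"
      unfolding W'_eq of_real_mult complex_norm_square by (simp add: algebra_simps power2_eq_square)
    then have "Re (cnj \<nu> * W' z) = (cmod \<nu>)\<^sup>2 * X * Re \<nu> - Re (cnj \<nu> * lam)"
      by (simp del: of_real_mult)
    moreover have "X < 0"
    proof -
      \<comment> \<open>The only positive term of \<open>X\<close> is \<open>a^2\<close>, and
        \<open>z > D\<close> makes \<open>8 M^2 z / D\<close> exceed it by virtue of
        \<open>a^2 < M^2\<close>.\<close>
      have "M\<^sup>2 * 1 \<le> M\<^sup>2 * (z / D)" using z D0 by (intro mult_left_mono) (auto simp: field_simps)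
      moreover have "8 * M\<^sup>2 * z / D = 8 * (M\<^sup>2 * (z / D))" by simp
      ultimately have "a\<^sup>2 < 8 * M\<^sup>2 * z / D" using \<open>a\<^sup>2 < M\<^sup>2\<close> zero_le_power2[of M] by linarith
      moreover have "0 \<le> z * (z - D)" "0 \<le> 4 * M\<^sup>2 * z / (z - D)" using z D0 by auto
      ultimately show ?thesis by (simp add: X_def)
    qed
    moreover have "0 < (cmod \<nu>)\<^sup>2 * Re \<nu>" using Re_\<nu> by (auto intro!: mult_pos_pos)
    ultimately show ?thesis
      using lam by (smt (verit) mult.assoc mult.commute mult_pos_neg)
  qed
  show ?thesis
  proof
    fix x
    obtain r where r: "rp < r" "x = rs r" using ex_r by blast
    have "Rr ((r - rm) + rm) = 0"
      by (rule R_eq_0[OF neg]) (use r in \<open>auto simp: D_def\<close>)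
    moreover have "\<rho> r \<noteq> 0" using r Mrp M by (simp add: \<rho>_def add_nonneg_eq_0_iff)
    ultimately show "u x = 0" by (simp add: Rr_def r)
  qed
qed

end
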